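(* For any given $L>0$ and $c_0\in\mathbb R$, there is a finite number of solutions $u$ to $$\begin{cases} -u_{xx}+(u+c_0)^3-(u+c_0)+\zeta(x)=0, & x\in(0,L),\\ u(0)=u_x(L)=0.\end{cases}$$ They correspond, via $u(x)=\tilde v(x/L;L,\tilde z)-c_0$, to the zeros $\tilde z$ of the analytic function $\tilde z\mapsto f(L,\tilde z)$.
   Context: $\zeta$ is a real-analytic function with values in $(-1,0)$ on an open interval containing $[0,L]$. For $L>0$ and $\tilde z\in\mathbb R$, $\tilde v(\cdot;L,\tilde z)$ denotes the solution on $[0,1]$ of the initial value problem $$-\tilde v_{yy}(y)+L^2\big(\tilde v(y)^3-\tilde v(y)+\zeta(Ly)\big)=0\ \ (y\in(0,1)),\qquad \tilde v(0)=c_0,\quad \tilde v_y(0)=\tilde z,$$ and $f(L,\tilde z):=\tilde v_y(1;L,\tilde z)$ (for those $(L,\tilde z)$ for which the solution exists on all of $[0,1]$). *)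

theory Defs
  imports "HOL-Analysis.Analysis"
begin

definition real_analytic_on :: "(real \<Rightarrow> real) \<Rightarrow> real set \<Rightarrow> bool"
  where "real_analytic_on g S \<longleftrightarrow>
    open S \<and> (\<forall>x\<in>S. \<exists>F. (\<lambda>h. g (x + h)) has_fps_expansion F)"

(* u is a classical solution of - u'' + R(x, u) = 0 on (a, b), of class
   C^1([a, b]) and C^2((a, b)), with first derivative p; the derivatives at
   the end points a and b are one-sided. *)
definition solves_ode2 ::
    "real \<Rightarrow> real \<Rightarrow> (real \<Rightarrow> real \<Rightarrow> real) \<Rightarrow> (real \<Rightarrow> real) \<Rightarrow> (real \<Rightarrow> real) \<Rightarrow> bool"
  where "solves_ode2 a b R u p \<longleftrightarrow>
    (\<forall>x\<in>{a..b}. (u has_real_derivative p x) (at x within {a..b})) \<and>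
    continuous_on {a..b} p \<and>
    (\<exists>q. continuous_on {a<..<b} q \<and>
         (\<forall>x\<in>{a<..<b}. (p has_real_derivative q x) (at x) \<and> - q x + R x (u x) = 0))"

(* Functions on a closed interval are represented by the members of extensional,
   so that a set of such functions contains each of them exactly once. *)
definition bvp_solutions :: "(real \<Rightarrow> real) \<Rightarrow> real \<Rightarrow> real \<Rightarrow> (real \<Rightarrow> real) set"
  where "bvp_solutions \<zeta> c0 L = {u \<in> extensional {0..L}.
    \<exists>p. solves_ode2 0 L (\<lambda>x w. (w + c0)^3 - (w + c0) + \<zeta> x) u p \<and> u 0 = 0 \<and> p L = 0}"

definition ivp_solution ::
    "(real \<Rightarrow> real) \<Rightarrow> real \<Rightarrow> real \<Rightarrow> real \<Rightarrow> (real \<Rightarrow> real) \<Rightarrow> bool"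
  where "ivp_solution \<zeta> c0 L z v \<longleftrightarrow> v \<in> extensional {0..1} \<and>
    (\<exists>p. solves_ode2 0 1 (\<lambda>y w. L^2 * (w^3 - w + \<zeta> (L * y))) v p \<and> v 0 = c0 \<and> p 0 = z)"

definition shooting_domain :: "(real \<Rightarrow> real) \<Rightarrow> real \<Rightarrow> real \<Rightarrow> real set"
  where "shooting_domain \<zeta> c0 L = {z. \<exists>v. ivp_solution \<zeta> c0 L z v}"

(* The next two functions are meaningful only for z in shooting_domain. *)
definition v_tilde :: "(real \<Rightarrow> real) \<Rightarrow> real \<Rightarrow> real \<Rightarrow> real \<Rightarrow> real \<Rightarrow> real"
  where "v_tilde \<zeta> c0 L z = (THE v. ivp_solution \<zeta> c0 L z v)"

definition shooting_map :: "(real \<Rightarrow> real) \<Rightarrow> real \<Rightarrow> real \<Rightarrow> real \<Rightarrow> real"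
  where "shooting_map \<zeta> c0 L z = vector_derivative (v_tilde \<zeta> c0 L z) (at 1 within {0..1})"

end

theory Submission
  imports Defs "HOL-Complex_Analysis.Complex_Analysis"
begin

text \<open>A solution of the boundary value problem satisfies \<open>\<bar>u + c\<^sub>0\<bar> \<le> max \<bar>c\<^sub>0\<bar> 2\<close> by the
  maximum principle, so the zeros of the shooting map are bounded. For a perturbed initial
  slope \<open>z + h\<close> with complex \<open>h\<close> the Picard iterates are polynomials in \<open>h\<close> and converge uniformly
  on a disc whose radius depends only on a bound of the solution for \<open>z\<close>; hence the
  shooting map is analytic, and its domain contains a ball of fixed radius about each of
  its zeros. Accumulation points of zeros therefore lie in the domain, and the identity
  theorem makes the set of these points open. It is also closed and bounded, hence empty.\<close>

section \<open>Second order equations\<close>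

text \<open>The cubic term lets solutions of the initial value problem blow up before
  \<open>y = 1\<close>, so the shooting domain can be a proper subset of the line. An identity
  theorem inside the domain alone would leave a gap: zeros might accumulate at its boundary or fill
  a whole component. A radius common to all zeros closes it, and since this radius comes from a
  common bound of their solutions, the constants of the Picard iteration are kept explicit. The
  slope is complexified because uniform limits of polynomials on a complex disc are holomorphic,
  whereas on a real interval they need only be continuous. The iteration runs on the difference from
  a known solution: this difference is zero at \<open>h = 0\<close>, so small \<open>h\<close> keeps
  it in the unit disc, where the nonlinearity has a fixed Lipschitz constant.\<close>

lemma second_order_zero:
  fixes d e q :: "real \<Rightarrow> real"
  assumes d: "\<And>x. x \<in> {a..b} \<Longrightarrow> (d has_real_derivative e x) (at x within {a..b})"
    and e: "continuous_on {a..b} e"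
    and q: "\<And>x. x \<in> {a<..<b} \<Longrightarrow> (e has_real_derivative q x) (at x)"
    and le: "\<And>x. x \<in> {a<..<b} \<Longrightarrow> \<bar>q x\<bar> \<le> C * \<bar>d x\<bar>"
    and "d a = 0" "e a = 0" and x: "x \<in> {a..b}"
  shows "d x = 0"
proof -
  \<comment> \<open>Gronwall by a weight: 2de + 2eq is at most 2 (1 + max C 0) |d| |e|, hence at
    most k (d^2 + e^2). The factor \<open>exp (- k * x)\<close> therefore makes \<open>E\<close>
    nonincreasing from its initial value 0.\<close>
  define k where "k = 1 + max C 0"
  define E where "E = (\<lambda>x. exp (- k * x) * ((d x)\<^sup>2 + (e x)\<^sup>2))"
  have dc: "continuous_on {a..b} d"
    using d by (meson DERIV_continuous_on)
  have "E x \<le> E a"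
  proof (rule DERIV_nonpos_imp_decreasing_open[where f = E])
    show "a \<le> x" using x by simp
    show "continuous_on {a..x} E" unfolding E_def
      using dc e x by (intro continuous_intros) (auto intro: continuous_on_subset)
    fix y assume y: "a < y" "y < x"
    then have yy: "y \<in> {a<..<b}" "y \<in> {a..b}" using x by auto
    have "(d has_real_derivative e y) (at y)"
      using d[OF yy(2)] yy(1) at_within_Icc_at[of a y b] by auto
    then have D: "(E has_real_derivative
        exp (- k * y) * (2 * d y * e y + 2 * e y * q y - k * ((d y)\<^sup>2 + (e y)\<^sup>2))) (at y)"
      unfolding E_def using q[OF yy(1)]
      by (auto intro!: derivative_eq_intros simp: algebra_simps power2_eq_square)
    have "\<bar>e y * q y\<bar> \<le> \<bar>e y\<bar> * (max C 0 * \<bar>d y\<bar>)"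
      unfolding abs_mult by (rule mult_left_mono) (use le[OF yy(1)] mult_right_mono[of C "max C 0" "\<bar>d y\<bar>"] in auto)
    then have "2 * d y * e y + 2 * e y * q y \<le> k * (2 * (\<bar>d y\<bar> * \<bar>e y\<bar>))"
      using abs_ge_self[of "d y * e y"] abs_ge_self[of "e y * q y"]
      unfolding k_def by (simp add: abs_mult algebra_simps)
    also have "\<dots> \<le> k * ((d y)\<^sup>2 + (e y)\<^sup>2)"
      using sum_squares_bound[of "\<bar>d y\<bar>" "\<bar>e y\<bar>"] by (intro mult_left_mono) (auto simp: k_def)
    finally show "\<exists>D. (E has_real_derivative D) (at y) \<and> D \<le> 0"
      by (intro exI conjI) (rule D, simp add: mult_nonneg_nonpos)
  qed
  then have "(d x)\<^sup>2 + (e x)\<^sup>2 \<le> 0" using assms by (simp add: E_def mult_le_0_iff)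
  then show ?thesis by (simp add: sum_power2_le_zero_iff)
qed

lemma solves_ode2_continuous:
  "solves_ode2 a b R u p \<Longrightarrow> continuous_on {a..b} u"
  unfolding solves_ode2_def by (meson DERIV_continuous_on)

lemma solves_ode2_bounded:
  assumes "solves_ode2 a b R u p"
  obtains M where "\<And>x. x \<in> {a..b} \<Longrightarrow> \<bar>u x\<bar> \<le> M"
proof -
  have "compact (u ` {a..b})"
    using assms by (intro compact_continuous_image solves_ode2_continuous) auto
  then obtain M where "\<forall>w\<in>u ` {a..b}. \<bar>w\<bar> \<le> M"
    using compact_imp_bounded bounded_iff by (metis real_norm_def)
  then show thesis by (intro that[of M]) auto
qed

lemma solves_ode2_cong:
  assumes "solves_ode2 a b R u p" "\<And>x. x \<in> {a..b} \<Longrightarrow> u x = v x"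
    "\<And>x w. x \<in> {a<..<b} \<Longrightarrow> R x w = S x w"
  shows "solves_ode2 a b S v p"
proof -
  have "\<forall>x\<in>{a..b}. (v has_real_derivative p x) (at x within {a..b})"
    using assms unfolding solves_ode2_def
    by (metis has_field_derivative_transform_within zero_less_one)
  then show ?thesis using assms unfolding solves_ode2_def by auto
qed

text \<open>Both solutions are bounded on the compact interval, so a Lipschitz constant for bounded
  values suffices, and the difference falls under \<open>second_order_zero\<close>.\<close>

lemma solves_ode2_unique:
  assumes u: "solves_ode2 a b R u p" and v: "solves_ode2 a b R v q"
    and init: "u a = v a" "p a = q a" and x: "x \<in> {a..b}"
    and lip: "\<And>M. \<exists>C. \<forall>x\<in>{a<..<b}. \<forall>w w'. \<bar>w\<bar> \<le> M \<longrightarrow> \<bar>w'\<bar> \<le> M \<longrightarrow> \<bar>R x w - R x w'\<bar> \<le> C * \<bar>w - w'\<bar>"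
  shows "u x = v x"
proof -
  obtain M\<^sub>1 where M\<^sub>1: "\<And>x. x \<in> {a..b} \<Longrightarrow> \<bar>u x\<bar> \<le> M\<^sub>1"
    using u by (rule solves_ode2_bounded) blast
  obtain M\<^sub>2 where M\<^sub>2: "\<And>x. x \<in> {a..b} \<Longrightarrow> \<bar>v x\<bar> \<le> M\<^sub>2"
    using v by (rule solves_ode2_bounded) blast
  define M where "M = max M\<^sub>1 M\<^sub>2"
  have M: "\<bar>u x\<bar> \<le> M" "\<bar>v x\<bar> \<le> M" if "x \<in> {a..b}" for x
    using M\<^sub>1[OF that] M\<^sub>2[OF that] by (simp_all add: M_def)
  obtain C where C: "\<forall>x\<in>{a<..<b}. \<forall>w w'. \<bar>w\<bar> \<le> M \<longrightarrow> \<bar>w'\<bar> \<le> M \<longrightarrow> \<bar>R x w - R x w'\<bar> \<le> C * \<bar>w - w'\<bar>"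
    using lip by blast
  have "u x - v x = 0"
  proof (rule second_order_zero[where d = "\<lambda>x. u x - v x" and e = "\<lambda>x. p x - q x"
        and q = "\<lambda>x. R x (u x) - R x (v x)" and C = C and a = a and b = b])
    fix x assume x: "x \<in> {a<..<b}"
    then show "\<bar>R x (u x) - R x (v x)\<bar> \<le> C * \<bar>u x - v x\<bar>" using C M[of x] by simp
    have "(p has_real_derivative R x (u x)) (at x)" "(q has_real_derivative R x (v x)) (at x)"
      using u v x unfolding solves_ode2_def by force+
    then show "((\<lambda>x. p x - q x) has_real_derivative R x (u x) - R x (v x)) (at x)"
      by (intro derivative_intros)
  qed (use assms in \<open>auto simp: solves_ode2_def intro!: continuous_intros derivative_intros\<close>)
  then show ?thesis by simp
qed

text \<open>Maximum principle with a Neumann condition at \<open>b\<close>. At a maximum above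
  \<open>M\<close> the slope is zero; just to its left \<open>u\<close> still exceeds
  \<open>M\<close>, so \<open>p\<close> increases to 0 and is negative there, and \<open>u\<close>
  decreases towards its maximum, which is absurd. Only the left side is examined, so a maximum at
  \<open>b\<close> is covered too.\<close>

lemma solves_ode2_le:
  assumes u: "solves_ode2 a b R u p" and init: "u a \<le> M" "p b = 0" and x: "x \<in> {a..b}"
    and pos: "\<And>x w. x \<in> {a<..<b} \<Longrightarrow> M < w \<Longrightarrow> 0 < R x w"
  shows "u x \<le> M"
proof (rule ccontr)
  assume nle: "\<not> u x \<le> M"
  have uc: "continuous_on {a..b} u" using u by (rule solves_ode2_continuous)
  obtain y where y: "y \<in> {a..b}" and ymax: "\<And>t. t \<in> {a..b} \<Longrightarrow> u t \<le> u y"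
    using continuous_attains_sup[OF _ _ uc] x by (auto simp: ball_def)
  have uy: "M < u y" using ymax[OF x] nle by simp
  with init y have ay: "a < y" by (cases "a = y") auto
  have du: "(u has_real_derivative p t) (at t)" if "t \<in> {a<..<b}" for t
    using u that at_within_Icc_at[of a t b] unfolding solves_ode2_def by (metis greaterThanLessThan_iff greaterThanLessThan_subseteq_atLeastAtMost_iff order_refl subsetD)
  have dp: "(p has_real_derivative R t (u t)) (at t)" if "t \<in> {a<..<b}" for t
    using u that unfolding solves_ode2_def by force
  have py: "p y = 0"
  proof (cases "y = b")
    case False
    then have yy: "y \<in> {a<..<b}" using y ay by auto
    have "u t \<le> u y" if "\<bar>y - t\<bar> < min (y - a) (b - y)" for t
      using that yy by (intro ymax) auto
    then show ?thesis
      using DERIV_local_max[OF du[OF yy], of "min (y - a) (b - y)"] yy by auto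
  qed (use init in simp)
  have "\<exists>d>0. \<forall>t\<in>{a..b}. dist t y < d \<longrightarrow> dist (u t) (u y) < u y - M"
    using uc y uy unfolding continuous_on_iff by (metis diff_gt_0_iff_gt)
  then obtain d where d: "d > 0" "\<And>t. t \<in> {a..b} \<Longrightarrow> \<bar>t - y\<bar> < d \<Longrightarrow> M < u t"
    by (force simp: dist_real_def abs_if split: if_splits)
  \<comment> \<open>Halving \<open>d\<close> keeps [s, y] strictly within the neighbourhood where
    \<open>u\<close> exceeds \<open>M\<close>; the maximum with \<open>a\<close> keeps it in the
    interval.\<close>
  define s where "s = max a (y - d / 2)"
  have s: "a \<le> s" "s < y" "y - s < d" using d ay by (auto simp: s_def max_def)
  have neg: "p t < 0" if t: "s < t" "t < y" for t
  proof -
    have "p t < p y"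
    proof (rule DERIV_pos_imp_increasing_open[OF t(2)])
      fix r assume r: "t < r" "r < y"
      then have "r \<in> {a<..<b}" "\<bar>r - y\<bar> < d" using s t y by auto
      then show "\<exists>l. (p has_real_derivative l) (at r) \<and> 0 < l"
        using dp pos d(2)[of r] by (metis greaterThanLessThan_subseteq_atLeastAtMost_iff order_refl subsetD)
    qed (use u s t y in \<open>auto simp: solves_ode2_def intro: continuous_on_subset\<close>)
    then show ?thesis using py by simp
  qed
  have "u y < u s"
  proof (rule DERIV_neg_imp_decreasing_open[OF s(2)])
    fix t assume "s < t" "t < y"
    then show "\<exists>l. (u has_real_derivative l) (at t) \<and> l < 0"
      using du[of t] neg[of t] s y by auto
  qed (use uc s y in \<open>auto intro: continuous_on_subset\<close>)
  then show False using ymax[of s] s y by auto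
qed

text \<open>Reflection turns the upper bound of the maximum principle into a lower bound.\<close>

lemma solves_ode2_uminus:
  "solves_ode2 a b R u p \<Longrightarrow> solves_ode2 a b (\<lambda>x w. - R x (- w)) (\<lambda>x. - u x) (\<lambda>x. - p x)"
  unfolding solves_ode2_def
  apply (elim conjE exE)
  subgoal for q by (intro conjI exI[of _ "\<lambda>x. - q x"]) (auto intro!: derivative_intros continuous_intros)
  done

text \<open>Serves both directions of the correspondence: \<open>k = L\<close> with shift
  \<open>c0\<close>, and \<open>k = 1 / L\<close> with shift \<open>- c0\<close>. The factor
  \<open>k\<^sup>2\<close> comes from differentiating twice.\<close>

lemma solves_ode2_rescale:
  assumes u: "solves_ode2 a b R u p" and k: "k > 0"
    and S: "\<And>y w. y \<in> {a / k<..<b / k} \<Longrightarrow> S y w = k\<^sup>2 * R (k * y) (w - c)"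
  shows "solves_ode2 (a / k) (b / k) S (\<lambda>y. u (k * y) + c) (\<lambda>y. k * p (k * y))"
proof -
  from u obtain q where q: "continuous_on {a<..<b} q"
    and dp: "\<And>x. x \<in> {a<..<b} \<Longrightarrow> (p has_real_derivative q x) (at x)"
    and R: "\<And>x. x \<in> {a<..<b} \<Longrightarrow> - q x + R x (u x) = 0"
    unfolding solves_ode2_def by blast
  have img: "(\<lambda>y. k * y) ` {a / k..b / k} \<subseteq> {a..b}"
    using k by (auto simp: field_simps)
  have imo: "k * y \<in> {a<..<b}" if "y \<in> {a / k<..<b / k}" for y
    using k that by (auto simp: field_simps)
  have d: "((\<lambda>y. u (k * y) + c) has_real_derivative k * p (k * y)) (at y within {a / k..b / k})"
    if y: "y \<in> {a / k..b / k}" for y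
  proof -
    have "(u has_real_derivative p (k * y)) (at (k * y) within (\<lambda>y. k * y) ` {a / k..b / k})"
      using u img y unfolding solves_ode2_def by (meson DERIV_subset image_subset_iff)
    then have "((\<lambda>y. u (k * y)) has_real_derivative p (k * y) * k) (at y within {a / k..b / k})"
      by (rule DERIV_image_chain[where g = "\<lambda>y. k * y", unfolded o_def]) (auto intro!: derivative_eq_intros)
    then show ?thesis by (auto intro!: derivative_eq_intros simp: mult.commute)
  qed
  have "continuous_on {a / k..b / k} (\<lambda>y. k * p (k * y))"
    using u img unfolding solves_ode2_def
    by (intro continuous_intros continuous_on_compose2[where f = "\<lambda>y. k * y" and g = p]) auto
  moreover have "continuous_on {a / k<..<b / k} (\<lambda>y. k\<^sup>2 * q (k * y))"
    using imo by (intro continuous_intros continuous_on_compose2[OF q]) auto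
  moreover have "((\<lambda>y. k * p (k * y)) has_real_derivative k\<^sup>2 * q (k * y)) (at y)"
    if y: "y \<in> {a / k<..<b / k}" for y
    using DERIV_chain2[where g = "\<lambda>y. k * y" and Db = k and s = UNIV, OF dp[OF imo[OF y]]]
    by (auto intro!: derivative_eq_intros simp: power2_eq_square)
  moreover have "- (k\<^sup>2 * q (k * y)) + S y (u (k * y) + c) = 0" if y: "y \<in> {a / k<..<b / k}" for y
    using R[OF imo[OF y]] S[OF y] by (simp add: algebra_simps)
  ultimately show ?thesis using d unfolding solves_ode2_def by blast
qed

section \<open>Holomorphic dependence on the initial slope\<close>

definition primitive :: "(real \<Rightarrow> 'a::banach) \<Rightarrow> real \<Rightarrow> 'a"
  where "primitive g y = integral {0..y} g"

lemma primitive_0 [simp]: "primitive g 0 = 0"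
  by (simp add: primitive_def)

lemma has_vector_derivative_primitive:
  "continuous_on {0..1} g \<Longrightarrow> y \<in> {0..1} \<Longrightarrow>
    (primitive g has_vector_derivative g y) (at y within {0..1})"
  unfolding primitive_def by (rule integral_has_vector_derivative)

lemma continuous_on_primitive:
  "continuous_on {0..1} g \<Longrightarrow> continuous_on {0..1} (primitive g)"
  by (meson has_vector_derivative_continuous has_vector_derivative_primitive
      continuous_on_eq_continuous_within)

lemma integrable_initial_segment:
  fixes g :: "real \<Rightarrow> 'a::banach"
  shows "continuous_on {0..1} g \<Longrightarrow> y \<in> {0..1} \<Longrightarrow> g integrable_on {0..y}"
  by (rule integrable_continuous_real) (auto intro: continuous_on_subset)

lemma primitive_diff:
  assumes "continuous_on {0..1} f" "continuous_on {0..1} g" "y \<in> {0..1}"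
  shows "primitive f y - primitive g y = primitive (\<lambda>s. f s - g s) y"
  unfolding primitive_def
  using assms by (simp add: Henstock_Kurzweil_Integration.integral_diff integrable_initial_segment)

lemma primitive_cong:
  "(\<And>s. s \<in> {0..1} \<Longrightarrow> f s = g s) \<Longrightarrow> y \<in> {0..1} \<Longrightarrow> primitive f y = primitive g y"
  unfolding primitive_def by (rule Henstock_Kurzweil_Integration.integral_cong) auto

text \<open>In the norm weighted by \<open>exp (l * s)\<close>, integration gains a factor 1/l. A
  large \<open>l\<close> thus makes integral operators contract on the whole interval, with no
  subdivision into short pieces.\<close>

lemma norm_primitive_le:
  assumes g: "continuous_on {0..1} g" and l: "l > 0" and y: "y \<in> {0..1}"
    and bound: "\<And>s. s \<in> {0..1} \<Longrightarrow> norm (g s) \<le> A * exp (l * s)"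
  shows "norm (primitive g y) \<le> A / l * exp (l * y)"
proof -
  have "0 \<le> A" using bound[of 0] norm_ge_zero[of "g 0"] by (simp del: norm_ge_zero)
  have I: "((\<lambda>s. A * exp (l * s)) has_integral A / l * exp (l * y) - A / l * exp (l * 0)) {0..y}"
    using l y by (intro fundamental_theorem_of_calculus)
      (auto intro!: derivative_eq_intros simp flip: has_real_derivative_iff_has_vector_derivative)
  have "norm (primitive g y) \<le> integral {0..y} (\<lambda>s. A * exp (l * s))"
    unfolding primitive_def
    using integrable_initial_segment[OF g y] I bound y
    by (intro integral_norm_bound_integral) (auto simp: integrable_on_def)
  also have "\<dots> \<le> A / l * exp (l * y)"
    using integral_unique[OF I] \<open>0 \<le> A\<close> l by simp
  finally show ?thesis .
qed

lemma primitive_in_Reals: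
  fixes g :: "real \<Rightarrow> complex"
  assumes "continuous_on {0..1} g" "\<And>s. s \<in> {0..1} \<Longrightarrow> g s \<in> \<real>" "y \<in> {0..1}"
  shows "primitive g y \<in> \<real>"
proof -
  have "Im (primitive g y) = integral {0..y} (\<lambda>s. Im (g s))"
    unfolding primitive_def using integral_linear[OF _ bounded_linear_Im, of g "{0..y}"] assms
    by (simp add: integrable_initial_segment o_def)
  also have "\<dots> = integral {0..y} (\<lambda>s. 0)"
    using assms by (intro Henstock_Kurzweil_Integration.integral_cong) (auto simp: complex_is_Real_iff)
  finally show ?thesis by (simp add: complex_is_Real_iff)
qed

text \<open>Such functions are holomorphic in the parameter, and unlike holomorphy this
  property is evidently inherited by the integral over the second variable.\<close>

definition polynomial_in_parameter :: "(complex \<Rightarrow> real \<Rightarrow> complex) \<Rightarrow> bool"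
  where "polynomial_in_parameter f \<longleftrightarrow> (\<exists>N A. (\<forall>y\<in>{0..1}. degree (A y) \<le> N) \<and>
    (\<forall>k. continuous_on {0..1} (\<lambda>y. coeff (A y) k)) \<and> (\<forall>h. \<forall>y\<in>{0..1}. f h y = poly (A y) h))"

lemma polynomial_in_parameter_const:
  assumes "continuous_on {0..1} g"
  shows "polynomial_in_parameter (\<lambda>h. g)"
  unfolding polynomial_in_parameter_def
proof (intro exI conjI)
  show "\<forall>k. continuous_on {0..1} (\<lambda>y. coeff [:g y:] k)"
  proof
    show "continuous_on {0..1} (\<lambda>y. coeff [:g y:] k)" for k
      using assms by (cases k) auto
  qed
qed auto

lemma polynomial_in_parameter_id: "polynomial_in_parameter (\<lambda>h y. h)"
  unfolding polynomial_in_parameter_def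
  by (rule exI[of _ 1], rule exI[of _ "\<lambda>_. [:0, 1:]"]) auto

lemma polynomial_in_parameter_add:
  assumes "polynomial_in_parameter f" "polynomial_in_parameter g"
  shows "polynomial_in_parameter (\<lambda>h y. f h y + g h y)"
proof -
  obtain N A M B where "\<forall>y\<in>{0..1}. degree (A y) \<le> N" "\<forall>y\<in>{0..1}. degree (B y) \<le> M"
    "\<forall>k. continuous_on {0..1} (\<lambda>y. coeff (A y) k)" "\<forall>k. continuous_on {0..1} (\<lambda>y. coeff (B y) k)"
    "\<forall>h. \<forall>y\<in>{0..1}. f h y = poly (A y) h" "\<forall>h. \<forall>y\<in>{0..1}. g h y = poly (B y) h"
    using assms unfolding polynomial_in_parameter_def by blast
  then show ?thesis unfolding polynomial_in_parameter_def
    by (intro exI[of _ "max N M"] exI[of _ "\<lambda>y. A y + B y"])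
      (auto intro!: degree_add_le continuous_intros intro: max.coboundedI1 max.coboundedI2)
qed

lemma polynomial_in_parameter_mult:
  assumes "polynomial_in_parameter f" "polynomial_in_parameter g"
  shows "polynomial_in_parameter (\<lambda>h y. f h y * g h y)"
proof -
  obtain N A M B where *: "\<forall>y\<in>{0..1}. degree (A y) \<le> N" "\<forall>y\<in>{0..1}. degree (B y) \<le> M"
    "\<forall>k. continuous_on {0..1} (\<lambda>y. coeff (A y) k)" "\<forall>k. continuous_on {0..1} (\<lambda>y. coeff (B y) k)"
    "\<forall>h. \<forall>y\<in>{0..1}. f h y = poly (A y) h" "\<forall>h. \<forall>y\<in>{0..1}. g h y = poly (B y) h"
    using assms unfolding polynomial_in_parameter_def by blast
  have "degree (A y * B y) \<le> N + M" if "y \<in> {0..1}" for y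
    using that * degree_mult_le[of "A y" "B y"] by (meson add_mono order_trans)
  with * show ?thesis unfolding polynomial_in_parameter_def
    by (intro exI[of _ "N + M"] exI[of _ "\<lambda>y. A y * B y"])
      (auto intro!: continuous_intros simp: coeff_mult)
qed

text \<open>Integrate coefficient by coefficient. The degree bound uniform in \<open>y\<close> gives
  a sum over a fixed range, which can be exchanged with the integral.\<close>

lemma polynomial_in_parameter_primitive:
  assumes "polynomial_in_parameter f"
  shows "polynomial_in_parameter (\<lambda>h. primitive (f h))"
proof -
  obtain N A where A: "\<And>y. y \<in> {0..1} \<Longrightarrow> degree (A y) \<le> N"
    "\<And>k. continuous_on {0..1} (\<lambda>y. coeff (A y) k)" "\<And>h y. y \<in> {0..1} \<Longrightarrow> f h y = poly (A y) h"
    using assms unfolding polynomial_in_parameter_def by blast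
  define I where "I = (\<lambda>y. \<Sum>k\<le>N. monom (primitive (\<lambda>y. coeff (A y) k) y) k)"
  have cI: "coeff (I y) k = (if k \<le> N then primitive (\<lambda>y. coeff (A y) k) y else 0)" for y k
    by (simp add: I_def coeff_sum)
  have "primitive (f h) y = poly (I y) h" if y: "y \<in> {0..1}" for h y
  proof -
    have "f h s = (\<Sum>k\<le>N. coeff (A s) k * h ^ k)" if "s \<in> {0..1}" for s
      using A(1,3)[OF that] by (auto simp: poly_altdef intro!: sum.mono_neutral_left intro: le_degree)
    then have "primitive (f h) y = primitive (\<lambda>s. \<Sum>k\<le>N. coeff (A s) k * h ^ k) y"
      using y by (intro primitive_cong)
    also have "\<dots> = (\<Sum>k\<le>N. primitive (\<lambda>y. coeff (A y) k) y * h ^ k)"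
      unfolding primitive_def using y A(2)
      by (subst integral_sum)
        (auto intro!: sum.cong integrable_initial_segment continuous_intros)
    finally show ?thesis by (simp add: I_def poly_sum poly_monom)
  qed
  moreover have "\<forall>y\<in>{0..1}. degree (I y) \<le> N"
    by (auto intro!: degree_le simp: cI)
  moreover have "\<forall>k. continuous_on {0..1} (\<lambda>y. coeff (I y) k)"
  proof
    show "continuous_on {0..1} (\<lambda>y. coeff (I y) k)" for k
      unfolding cI by (cases "k \<le> N") (simp_all add: continuous_on_primitive A(2))
  qed
  ultimately show ?thesis unfolding polynomial_in_parameter_def by blast
qed

lemma polynomial_in_parameter_continuous:
  assumes "polynomial_in_parameter f"
  shows "continuous_on {0..1} (f h)"
proof -
  obtain N A where A: "\<And>y. y \<in> {0..1} \<Longrightarrow> degree (A y) \<le> N"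
    "\<And>k. continuous_on {0..1} (\<lambda>y. coeff (A y) k)" "\<And>h y. y \<in> {0..1} \<Longrightarrow> f h y = poly (A y) h"
    using assms unfolding polynomial_in_parameter_def by blast
  have "f h y = (\<Sum>k\<le>N. coeff (A y) k * h ^ k)" if "y \<in> {0..1}" for y
    using A(1,3)[OF that] by (auto simp: poly_altdef intro!: sum.mono_neutral_left intro: le_degree)
  moreover have "continuous_on {0..1} (\<lambda>y. \<Sum>k\<le>N. coeff (A y) k * h ^ k)"
    by (intro continuous_intros A)
  ultimately show ?thesis by (subst continuous_on_cong[OF refl]) auto
qed

lemma polynomial_in_parameter_holomorphic:
  assumes "polynomial_in_parameter f" "y \<in> {0..1}"
  shows "(\<lambda>h. f h y) holomorphic_on S"
proof -
  obtain P where "\<forall>h. f h y = poly P h"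
    using assms unfolding polynomial_in_parameter_def by blast
  then have "(\<lambda>h. f h y) = poly P" by auto
  then show ?thesis
    by (metis field_differentiable_def field_differentiable_at_within holomorphic_on_def poly_DERIV)
qed

text \<open>The difference \<open>w\<close> of two solutions of the cubic equation satisfies an equation
  \<open>w'' = a w + b w\<^sup>2 + c w\<^sup>3\<close>. The weight \<open>exp (rate * y)\<close> makes the Picard step a
  contraction on all of \<open>[0, 1]\<close>, and \<open>radius\<close> depends on the bound \<open>B\<close> only; this
  uniformity is needed in the finiteness proof.\<close>

locale cubic_picard =
  fixes a b :: "real \<Rightarrow> real" and c B :: real
  assumes a: "continuous_on {0..1} a" and b: "continuous_on {0..1} b"
    and B: "\<And>s. s \<in> {0..1} \<Longrightarrow> \<bar>a s\<bar> + 2 * \<bar>b s\<bar> + 3 * \<bar>c\<bar> \<le> B"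
begin

definition G :: "real \<Rightarrow> complex \<Rightarrow> complex"
  where "G s w = of_real (a s) * w + of_real (b s) * w\<^sup>2 + of_real c * w ^ 3"

text \<open>Chosen so that B / rate <= 1/2, the factor gained by the inner integral of
  \<open>step\<close>, and 1 / rate <= 1, so that the outer integral loses nothing.\<close>

abbreviation rate :: real where "rate \<equiv> 2 * B + 1"

text \<open>The largest size of \<open>h\<close> with 2 |h| exp rate <= 1. The iterates are bounded
  by 2 |h| exp (rate y), so they stay in the unit disc, where \<open>G_lipschitz\<close>
  applies.\<close>

abbreviation radius :: real where "radius \<equiv> exp (- rate) / 2"

text \<open>Integral form of w'' = G(y, w) with w(0) = 0 and w'(0) = h: the solutions are the fixed
  points.\<close>

definition step :: "complex \<Rightarrow> (real \<Rightarrow> complex) \<Rightarrow> real \<Rightarrow> complex"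
  where "step h w = primitive (\<lambda>t. h + primitive (\<lambda>s. G s (w s)) t)"

primrec iter :: "nat \<Rightarrow> complex \<Rightarrow> real \<Rightarrow> complex"
  where "iter 0 h = (\<lambda>_. 0)"
  | "iter (Suc n) h = step h (iter n h)"

lemma B_nonneg: "0 \<le> B"
  using B[of 0] by auto

lemma G_0 [simp]: "G s 0 = 0"
  by (simp add: G_def)

lemma continuous_on_G:
  "continuous_on {0..1} w \<Longrightarrow> continuous_on {0..1} (\<lambda>s. G s (w s))"
  unfolding G_def by (intro continuous_intros a b)

text \<open>Factor out w - w'. The weights 1, 2, 3 in the assumption on \<open>B\<close> bound the
  remaining factors 1, w + w' and w^2 + w w' + w'^2 on the unit disc.\<close>

lemma G_lipschitz:
  assumes s: "s \<in> {0..1}" and w: "norm w \<le> 1" "norm w' \<le> 1"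
  shows "norm (G s w - G s w') \<le> B * norm (w - w')"
proof -
  have "norm (w + w') \<le> 2" using norm_triangle_le[of w w' 2] w by simp
  have "norm (w\<^sup>2) \<le> 1" "norm (w'\<^sup>2) \<le> 1" "norm (w * w') \<le> 1"
    using w by (simp_all add: norm_power norm_mult power_le_one mult_le_one)
  then have 3: "norm (w\<^sup>2 + w * w' + w'\<^sup>2) \<le> 3"
    by (intro norm_triangle_le) (smt (verit) norm_triangle_ineq)
  have "G s w - G s w' = (of_real (a s) + of_real (b s) * (w + w')
      + of_real c * (w\<^sup>2 + w * w' + w'\<^sup>2)) * (w - w')"
    unfolding G_def by (simp add: algebra_simps power2_eq_square power3_eq_cube)
  also have "norm \<dots> \<le> (\<bar>a s\<bar> + \<bar>b s\<bar> * norm (w + w') + \<bar>c\<bar> * norm (w\<^sup>2 + w * w' + w'\<^sup>2)) * norm (w - w')"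
    unfolding norm_mult[of _ "w - w'"]
    by (intro mult_right_mono norm_triangle_mono) (simp_all add: norm_mult)
  also have "\<dots> \<le> (\<bar>a s\<bar> + \<bar>b s\<bar> * 2 + \<bar>c\<bar> * 3) * norm (w - w')"
    using \<open>norm (w + w') \<le> 2\<close> 3 by (intro mult_right_mono add_mono mult_left_mono) auto
  also have "\<dots> \<le> B * norm (w - w')"
    using B[OF s] by (intro mult_right_mono) auto
  finally show ?thesis .
qed

lemma continuous_on_slope:
  "continuous_on {0..1} w \<Longrightarrow> continuous_on {0..1} (\<lambda>t. h + primitive (\<lambda>s. G s (w s)) t)"
  by (intro continuous_intros continuous_on_primitive continuous_on_G)

text \<open>The estimate for the inner integral is separate from \<open>step_contraction\<close>
  because the derivative at \<open>y = 1\<close>, the quantity of interest, is itself such an inner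
  integral.\<close>

lemma slope_lipschitz:
  assumes u: "continuous_on {0..1} u" "\<And>s. s \<in> {0..1} \<Longrightarrow> norm (u s) \<le> 1"
    and v: "continuous_on {0..1} v" "\<And>s. s \<in> {0..1} \<Longrightarrow> norm (v s) \<le> 1"
    and uv: "\<And>s. s \<in> {0..1} \<Longrightarrow> norm (u s - v s) \<le> A * exp (rate * s)" and t: "t \<in> {0..1}"
  shows "norm (primitive (\<lambda>s. G s (u s)) t - primitive (\<lambda>s. G s (v s)) t) \<le> A / 2 * exp (rate * t)"
proof -
  have "0 \<le> A" using uv[of 0] norm_ge_zero[of "u 0 - v 0"] by (simp del: norm_ge_zero)
  have "norm (G s (u s) - G s (v s)) \<le> (B * A) * exp (rate * s)" if "s \<in> {0..1}" for s
    using order_trans[OF G_lipschitz[OF that u(2)[OF that] v(2)[OF that]]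
        mult_left_mono[OF uv[OF that] B_nonneg]] by (simp add: mult.assoc)
  then have "norm (primitive (\<lambda>s. G s (u s)) t - primitive (\<lambda>s. G s (v s)) t)
      \<le> B * A / rate * exp (rate * t)"
    unfolding primitive_diff[OF continuous_on_G[OF u(1)] continuous_on_G[OF v(1)] t]
    using B_nonneg t by (intro norm_primitive_le continuous_intros continuous_on_G u v) auto
  also have "\<dots> \<le> A / 2 * exp (rate * t)"
    using B_nonneg \<open>0 \<le> A\<close> by (intro mult_right_mono) (auto simp: field_simps)
  finally show ?thesis .
qed

lemma step_contraction:
  assumes u: "continuous_on {0..1} u" "\<And>s. s \<in> {0..1} \<Longrightarrow> norm (u s) \<le> 1"
    and v: "continuous_on {0..1} v" "\<And>s. s \<in> {0..1} \<Longrightarrow> norm (v s) \<le> 1"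
    and uv: "\<And>s. s \<in> {0..1} \<Longrightarrow> norm (u s - v s) \<le> A * exp (rate * s)" and y: "y \<in> {0..1}"
  shows "norm (step h u y - step h v y) \<le> A / 2 * exp (rate * y)"
proof -
  have "0 \<le> A" using uv[of 0] norm_ge_zero[of "u 0 - v 0"] by (simp del: norm_ge_zero)
  have "norm (step h u y - step h v y) \<le> A / 2 / rate * exp (rate * y)"
    unfolding step_def primitive_diff[OF continuous_on_slope[OF u(1)] continuous_on_slope[OF v(1)] y]
    using B_nonneg y slope_lipschitz[OF u v uv]
    by (intro norm_primitive_le continuous_intros continuous_on_slope u v) auto
  also have "\<dots> \<le> A / 2 * exp (rate * y)"
    using B_nonneg \<open>0 \<le> A\<close> by (intro mult_right_mono) (auto simp: field_simps)
  finally show ?thesis .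
qed

lemma step_zero: 
  assumes "y \<in> {0..1}"
  shows "norm (step h (\<lambda>_. 0) y) \<le> norm h * exp (rate * y)"
proof -
  have "norm (step h (\<lambda>_. 0) y) = y * norm h"
    using assms by (simp add: step_def primitive_def norm_mult scaleR_conv_of_real)
  also have "\<dots> \<le> exp (rate * y) * norm h"
    using assms B_nonneg by (intro mult_right_mono) (auto intro: order_trans[where y = 1])
  finally show ?thesis by (simp add: mult.commute)
qed

lemma radius_bound:
  assumes "norm h \<le> radius" "y \<in> {0..1}"
  shows "2 * norm h * exp (rate * y) \<le> 1"
proof -
  have "2 * norm h * exp (rate * y) \<le> 2 * radius * exp (rate * 1)"
    using assms B_nonneg by (intro mult_mono) (auto intro!: mult_left_le)
  then show ?thesis by (simp flip: exp_add)
qed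

section \<open>The iterates: polynomial dependence on the slope and geometric convergence\<close>

lemma iter_polynomial: "polynomial_in_parameter (iter n)"
proof (induction n)
  case 0
  show ?case by (simp add: polynomial_in_parameter_const)
next
  case (Suc n)
  show ?case unfolding iter.simps(2) step_def G_def power2_eq_square power3_eq_cube
    by (intro polynomial_in_parameter_primitive polynomial_in_parameter_add
        polynomial_in_parameter_mult polynomial_in_parameter_const polynomial_in_parameter_id Suc
        continuous_intros a b)
qed

lemma slope_iter_polynomial:
  "polynomial_in_parameter (\<lambda>h t. h + primitive (\<lambda>s. G s (iter n h s)) t)"
  unfolding G_def power2_eq_square power3_eq_cube
  by (intro polynomial_in_parameter_primitive polynomial_in_parameter_add
      polynomial_in_parameter_mult polynomial_in_parameter_const polynomial_in_parameter_id
      iter_polynomial continuous_intros a b)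

lemmas continuous_on_iter = polynomial_in_parameter_continuous[OF iter_polynomial]

text \<open>The bound reproduces itself: the contraction halves 2 |h| to |h|, and the first step
  from zero adds another |h|. By \<open>radius_bound\<close> it also keeps the iterates in the unit
  disc, which the contraction needs.\<close>

lemma norm_iter_le:
  assumes h: "norm h \<le> radius" and y: "y \<in> {0..1}"
  shows "norm (iter n h y) \<le> 2 * norm h * exp (rate * y)"
  using y
proof (induction n arbitrary: y)
  case (Suc n)
  have "norm (iter (Suc n) h y) \<le> norm (step h (iter n h) y - step h (\<lambda>_. 0) y) + norm (step h (\<lambda>_. 0) y)"
    using norm_triangle_sub[of "step h (iter n h) y" "step h (\<lambda>_. 0) y"] by (simp add: add.commute)
  also have "norm (step h (iter n h) y - step h (\<lambda>_. 0) y) \<le> 2 * norm h / 2 * exp (rate * y)"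
    using Suc order_trans[OF Suc.IH radius_bound[OF h]]
    by (intro step_contraction continuous_on_iter continuous_intros) auto
  also have "norm (step h (\<lambda>_. 0) y) \<le> norm h * exp (rate * y)"
    using Suc by (intro step_zero)
  finally show ?case by simp
qed simp

lemma norm_iter_le_1: "norm h \<le> radius \<Longrightarrow> y \<in> {0..1} \<Longrightarrow> norm (iter n h y) \<le> 1"
  using norm_iter_le radius_bound order_trans by blast

lemma norm_iter_diff_le:
  assumes h: "norm h \<le> radius" and y: "y \<in> {0..1}"
  shows "norm (iter (Suc n) h y - iter n h y) \<le> norm h / 2 ^ n * exp (rate * y)"
  using y
proof (induction n arbitrary: y)
  case 0
  then show ?case using step_zero by simp
next
  case (Suc n)
  have "norm (step h (iter (Suc n) h) y - step h (iter n h) y) \<le> norm h / 2 ^ n / 2 * exp (rate * y)"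
    using Suc norm_iter_le_1[OF h] by (intro step_contraction continuous_on_iter) 
  then show ?case by (simp add: mult.commute)
qed

text \<open>The limit of the iterates, written as a telescoping series so that the Weierstrass
  M-test yields uniform convergence.\<close>

definition solution :: "complex \<Rightarrow> real \<Rightarrow> complex"
  where "solution h y = (\<Sum>n. iter (Suc n) h y - iter n h y)"

text \<open>Uniformity is joint: in \<open>y\<close> it gives continuity and passage to the limit
  under the integral, in \<open>h\<close> it gives holomorphy.\<close>

lemma iter_uniform_limit:
  "uniform_limit (cball 0 radius \<times> {0..1}) (\<lambda>n (h, y). iter n h y) (\<lambda>(h, y). solution h y) sequentially"
proof -
  have "norm (iter (Suc n) h y - iter n h y) \<le> (1 / 2) ^ n"
    if hy: "norm h \<le> radius" "y \<in> {0..1}" for n h y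
  proof -
    have "norm (iter (Suc n) h y - iter n h y) \<le> (norm h * exp (rate * y)) / 2 ^ n"
      using norm_iter_diff_le[OF hy] by simp
    also have "\<dots> \<le> 1 / 2 ^ n"
      using radius_bound[OF hy] by (intro divide_right_mono) auto
    finally show ?thesis by (simp add: power_divide)
  qed
  then have "uniform_limit (cball 0 radius \<times> {0..1})
      (\<lambda>n x. \<Sum>i<n. iter (Suc i) (fst x) (snd x) - iter i (fst x) (snd x))
      (\<lambda>x. solution (fst x) (snd x)) sequentially"
    unfolding solution_def
    by (intro Weierstrass_m_test[of _ _ "\<lambda>n. (1 / 2) ^ n"]) (auto simp del: iter.simps)
  moreover have "(\<Sum>i<n. iter (Suc i) (fst x) (snd x) - iter i (fst x) (snd x)) = iter n (fst x) (snd x)" for n x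
    using sum_lessThan_telescope[of "\<lambda>i. iter i (fst x) (snd x)" n] by (simp del: iter.simps(2))
  ultimately show ?thesis by (simp only: case_prod_unfold)
qed

lemma iter_uniform_limit':
  assumes "e > 0"
  obtains N where "\<And>n h y. n \<ge> N \<Longrightarrow> norm h \<le> radius \<Longrightarrow> y \<in> {0..1} \<Longrightarrow> norm (iter n h y - solution h y) < e"
proof -
  obtain N where "\<forall>n\<ge>N. \<forall>x\<in>cball 0 radius \<times> {0..1}.
      dist ((\<lambda>(h, y). iter n h y) x) ((\<lambda>(h, y). solution h y) x) < e"
    using iter_uniform_limit assms unfolding uniform_limit_sequentially_iff by blast
  then show thesis by (intro that[of N]) (force simp: dist_norm)
qed

text \<open>The weight is at least 1, so a plain uniform error already has the form that
  \<open>step_contraction\<close> and \<open>slope_lipschitz\<close> expect.\<close>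

lemma iter_weighted_limit:
  assumes "e > 0"
  obtains N where "\<And>n h y. n \<ge> N \<Longrightarrow> norm h \<le> radius \<Longrightarrow> y \<in> {0..1} \<Longrightarrow>
    norm (iter n h y - solution h y) \<le> e * exp (rate * y)"
proof (rule iter_uniform_limit'[OF assms])
  fix N assume N: "\<And>n h y. n \<ge> N \<Longrightarrow> norm h \<le> radius \<Longrightarrow> y \<in> {0..1} \<Longrightarrow>
    norm (iter n h y - solution h y) < e"
  show thesis
  proof (rule that)
    fix n and h :: complex and y :: real
    assume *: "n \<ge> N" "norm h \<le> radius" and y: "y \<in> {0..1}"
    have "norm (iter n h y - solution h y) \<le> e * 1" using N[OF * y] by simp
    also have "\<dots> \<le> e * exp (rate * y)"
      using y B_nonneg assms by (intro mult_left_mono) auto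
    finally show "norm (iter n h y - solution h y) \<le> e * exp (rate * y)" .
  qed
qed

lemma iter_tendsto:
  assumes "norm h \<le> radius" "y \<in> {0..1}"
  shows "(\<lambda>n. iter n h y) \<longlonglongrightarrow> solution h y"
  using tendsto_uniform_limitI[OF iter_uniform_limit, of "(h, y)"] assms by simp

lemma norm_solution_le_1:
  assumes "norm h \<le> radius" "y \<in> {0..1}"
  shows "norm (solution h y) \<le> 1"
  using assms by (intro Lim_norm_ubound[OF _ iter_tendsto]) (auto intro!: always_eventually norm_iter_le_1)

lemma continuous_on_solution:
  assumes h: "norm h \<le> radius"
  shows "continuous_on {0..1} (solution h)"
proof (rule uniform_limit_theorem)
  show "uniform_limit {0..1} (\<lambda>n. iter n h) (solution h) sequentially"
    unfolding uniform_limit_sequentially_iff dist_norm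
    by (intro allI impI) (erule iter_uniform_limit', use h in blast)
qed (auto intro!: always_eventually continuous_on_iter)

lemma solution_fixed_point:
  assumes h: "norm h \<le> radius" and y: "y \<in> {0..1}"
  shows "solution h y = step h (solution h) y"
proof -
  have "(\<lambda>n. iter (Suc n) h y) \<longlonglongrightarrow> step h (solution h) y"
  proof (rule LIMSEQ_I)
    fix e :: real assume e: "e > 0"
    \<comment> \<open>The factor \<open>exp (- rate)\<close> cancels the largest value of the
      weight, attained at \<open>y = 1\<close>, and leaves e / 2.\<close>
    define e' where "e' = e * exp (- rate)"
    have "e' > 0" using e by (simp add: e'_def)
    then obtain N where N: "\<And>n y. n \<ge> N \<Longrightarrow> y \<in> {0..1} \<Longrightarrow>
        norm (iter n h y - solution h y) \<le> e' * exp (rate * y)"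
      by (rule iter_weighted_limit) (use h in blast)
    have "norm (iter (Suc n) h y - step h (solution h) y) < e" if n: "n \<ge> N" for n
    proof -
      have "norm (step h (iter n h) y - step h (solution h) y) \<le> e' / 2 * exp (rate * y)"
        using h y n by (intro step_contraction continuous_on_iter continuous_on_solution
            norm_iter_le_1 norm_solution_le_1 N)
      also have "\<dots> \<le> e' / 2 * exp (rate * 1)"
        using \<open>e' > 0\<close> y B_nonneg by (intro mult_left_mono) (auto intro!: mult_left_le)
      also have "\<dots> < e" using e by (simp add: e'_def flip: exp_add)
      finally show ?thesis by simp
    qed
    then show "\<exists>N. \<forall>n\<ge>N. norm (iter (Suc n) h y - step h (solution h) y) < e" by blast
  qed
  moreover have "(\<lambda>n. iter (Suc n) h y) \<longlonglongrightarrow> solution h y"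
    using iter_tendsto[OF h y] by (rule LIMSEQ_Suc)
  ultimately show ?thesis by (rule LIMSEQ_unique[rotated])
qed

text \<open>The \<open>y\<close>-derivative of \<open>solution h\<close>, given as an integral so
  that its dependence on \<open>h\<close> can be followed without differentiating a limit.\<close>

definition slope :: "complex \<Rightarrow> real \<Rightarrow> complex"
  where "slope h t = h + primitive (\<lambda>s. G s (solution h s)) t"

text \<open>The slopes of the iterates are polynomials in \<open>h\<close> and converge uniformly on
  the disc, so Weierstrass' theorem applies.\<close>

lemma slope_holomorphic:
  assumes t: "t \<in> {0..1}"
  shows "(\<lambda>h. slope h t) holomorphic_on ball 0 radius"
proof (rule holomorphic_uniform_sequence)
  show "(\<lambda>h. h + primitive (\<lambda>s. G s (iter n h s)) t) holomorphic_on ball 0 radius" for n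
    using slope_iter_polynomial t by (rule polynomial_in_parameter_holomorphic)
  have lim: "uniform_limit (ball 0 radius) (\<lambda>n h. h + primitive (\<lambda>s. G s (iter n h s)) t)
      (\<lambda>h. slope h t) sequentially"
    unfolding uniform_limit_sequentially_iff dist_norm
  proof (intro allI impI)
    fix e :: real assume e: "e > 0"
    define e' where "e' = e * exp (- rate)"
    have "e' > 0" using e by (simp add: e'_def)
    then obtain N where N: "\<And>n h y. n \<ge> N \<Longrightarrow> norm h \<le> radius \<Longrightarrow> y \<in> {0..1} \<Longrightarrow>
        norm (iter n h y - solution h y) \<le> e' * exp (rate * y)"
      by (rule iter_weighted_limit) blast
    have "norm (h + primitive (\<lambda>s. G s (iter n h s)) t - slope h t) < e"
      if n: "n \<ge> N" and h: "norm h \<le> radius" for n h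
    proof -
      have "norm (primitive (\<lambda>s. G s (iter n h s)) t - primitive (\<lambda>s. G s (solution h s)) t)
          \<le> e' / 2 * exp (rate * t)"
        using h t n by (intro slope_lipschitz continuous_on_iter continuous_on_solution
            norm_iter_le_1 norm_solution_le_1 N)
      also have "\<dots> \<le> e' / 2 * exp (rate * 1)"
        using \<open>e' > 0\<close> t B_nonneg by (intro mult_left_mono) (auto intro!: mult_left_le)
      also have "\<dots> < e" using e by (simp add: e'_def flip: exp_add)
      finally show ?thesis by (simp add: slope_def)
    qed
    then show "\<exists>N. \<forall>n\<ge>N. \<forall>h\<in>ball 0 radius.
        norm (h + primitive (\<lambda>s. G s (iter n h s)) t - slope h t) < e"
      by (intro exI[of _ N]) auto
  qed
  fix x :: complex assume "x \<in> ball 0 radius"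
  then obtain d where "d > 0" "cball x d \<subseteq> ball 0 radius"
    using open_contains_cball open_ball by blast
  with lim show "\<exists>d>0. cball x d \<subseteq> ball 0 radius \<and> uniform_limit (cball x d)
      (\<lambda>n h. h + primitive (\<lambda>s. G s (iter n h s)) t) (\<lambda>h. slope h t) sequentially"
    by (meson uniform_limit_on_subset)
qed simp

section \<open>Back from complex slopes to real solutions\<close>

lemma G_in_Reals: "w \<in> \<real> \<Longrightarrow> G s w \<in> \<real>"
  by (simp add: G_def)

lemma slope_in_Reals:
  assumes "continuous_on {0..1} w" "\<And>s. s \<in> {0..1} \<Longrightarrow> w s \<in> \<real>" "h \<in> \<real>" "t \<in> {0..1}"
  shows "h + primitive (\<lambda>s. G s (w s)) t \<in> \<real>"
  using assms by (intro Reals_add primitive_in_Reals continuous_on_G G_in_Reals)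

text \<open>The coefficients of \<open>G\<close> are real, so for real \<open>h\<close> the complex
  iteration never leaves the real line.\<close>

lemma iter_in_Reals: "h \<in> \<real> \<Longrightarrow> y \<in> {0..1} \<Longrightarrow> iter n h y \<in> \<real>"
proof (induction n arbitrary: y)
  case (Suc n)
  then show ?case unfolding iter.simps(2) step_def
    by (intro primitive_in_Reals continuous_on_slope continuous_on_iter slope_in_Reals) auto
qed simp

lemma solution_in_Reals:
  assumes "h \<in> \<real>" "norm h \<le> radius" "y \<in> {0..1}"
  shows "solution h y \<in> \<real>"
  by (rule Lim_in_closed_set[OF closed_complex_Reals _ _ iter_tendsto])
    (use assms in \<open>auto intro!: always_eventually iter_in_Reals\<close>)

lemma real_solution:
  fixes h :: real
  assumes h: "\<bar>h\<bar> \<le> radius"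
  shows "solves_ode2 0 1 (\<lambda>y w. a y * w + b y * w\<^sup>2 + c * w ^ 3)
      (\<lambda>y. Re (solution (of_real h) y)) (\<lambda>y. Re (slope (of_real h) y))"
    and "solution (of_real h) 0 = 0" and "slope (of_real h) 0 = of_real h"
proof -
  let ?h = "of_real h :: complex"
  have nh: "norm ?h \<le> radius" using h by simp
  let ?w = "\<lambda>y. Re (solution ?h y)"
  have real: "solution ?h y = of_real (?w y)" if "y \<in> {0..1}" for y
    using solution_in_Reals[OF _ nh that] by (simp add: complex_is_Real_iff complex_eq_iff)
  show "solution ?h 0 = 0" "slope ?h 0 = ?h"
    using solution_fixed_point[OF nh, of 0] by (simp_all add: step_def slope_def)
  have dw: "(?w has_real_derivative Re (slope ?h y)) (at y within {0..1})" if y: "y \<in> {0..1}" for y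
  proof -
    have "(step ?h (solution ?h) has_vector_derivative slope ?h y) (at y within {0..1})"
      unfolding step_def slope_def using y
      by (intro has_vector_derivative_primitive continuous_on_slope continuous_on_solution nh)
    then have "(solution ?h has_vector_derivative slope ?h y) (at y within {0..1})"
      by (rule has_vector_derivative_transform[OF y, rotated]) (rule solution_fixed_point[OF nh])
    then show ?thesis
      using bounded_linear.has_vector_derivative[OF bounded_linear_Re]
      by (simp add: has_real_derivative_iff_has_vector_derivative)
  qed
  \<comment> \<open>\<open>Re\<close> does not commute with squares and cubes; the identity rests on
    \<open>solution ?h y\<close> being real.\<close>
  have ReG: "Re (G y (solution ?h y)) = a y * ?w y + b y * (?w y)\<^sup>2 + c * ?w y ^ 3"
    if "y \<in> {0..1}" for y
  proof -
    have "G y (solution ?h y) = of_real (a y * ?w y + b y * (?w y)\<^sup>2 + c * ?w y ^ 3)"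
      by (subst real[OF that]) (simp add: G_def)
    then show ?thesis by simp
  qed
  have dp: "((\<lambda>y. Re (slope ?h y)) has_real_derivative a y * ?w y + b y * (?w y)\<^sup>2 + c * ?w y ^ 3)
      (at y within {0..1})" if y: "y \<in> {0..1}" for y
  proof -
    have "(slope ?h has_vector_derivative 0 + G y (solution ?h y)) (at y within {0..1})"
      unfolding slope_def using y
      by (intro has_vector_derivative_add has_vector_derivative_const
          has_vector_derivative_primitive continuous_on_G continuous_on_solution nh)
    then show ?thesis
      using bounded_linear.has_vector_derivative[OF bounded_linear_Re] ReG[OF y]
      by (fastforce simp: has_real_derivative_iff_has_vector_derivative)
  qed
  have "continuous_on {0..1} (\<lambda>y. a y * w y + b y * (w y)\<^sup>2 + c * w y ^ 3)"
    if "continuous_on {0..1} w" for w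
    by (intro continuous_intros a b that)
  moreover have "continuous_on {0..1} ?w"
    using dw by (rule DERIV_continuous_on)
  ultimately have "continuous_on {0..1} (\<lambda>y. a y * ?w y + b y * (?w y)\<^sup>2 + c * ?w y ^ 3)"
    by blast
  then have "continuous_on {0<..<1} (\<lambda>y. a y * ?w y + b y * (?w y)\<^sup>2 + c * ?w y ^ 3)"
    by (rule continuous_on_subset) auto
  moreover have "continuous_on {0..1} (\<lambda>y. Re (slope ?h y))"
    using dp by (rule DERIV_continuous_on)
  moreover have "((\<lambda>y. Re (slope ?h y)) has_real_derivative
      a y * ?w y + b y * (?w y)\<^sup>2 + c * ?w y ^ 3) (at y)" if "y \<in> {0<..<1}" for y
    using dp[of y] that at_within_Icc_at[of 0 y 1] by auto
  ultimately show "solves_ode2 0 1 (\<lambda>y w. a y * w + b y * w\<^sup>2 + c * w ^ 3) ?w (\<lambda>y. Re (slope ?h y))"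
    using dw unfolding solves_ode2_def by auto
qed

end

section \<open>Real analytic functions\<close>

text \<open>Powers of a real \<open>h\<close> are real, so \<open>Re\<close> acts on the
  coefficients alone. The radius cannot shrink, since the new series converges at every positive
  real below the old radius.\<close>

lemma has_fps_expansion_Re:
  fixes F :: "complex fps"
  assumes g: "g has_fps_expansion F" and f: "\<forall>\<^sub>F h in nhds 0. f h = Re (g (of_real h))"
  shows "f has_fps_expansion Abs_fps (\<lambda>n. Re (fps_nth F n))"
proof -
  let ?R = "Abs_fps (\<lambda>n. Re (fps_nth F n))"
  have sums: "(\<lambda>n. Re (fps_nth F n) * h ^ n) sums Re (eval_fps F (of_real h))"
    if h: "ereal \<bar>h\<bar> < fps_conv_radius F" for h :: real
  proof -
    have "(\<lambda>n. fps_nth F n * of_real h ^ n) sums eval_fps F (of_real h)"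
      using h by (intro sums_eval_fps) simp
    from sums_Re[OF this] show ?thesis
      by (simp flip: of_real_power)
  qed
  have R: "fps_conv_radius F > 0" "\<forall>\<^sub>F z in nhds 0. eval_fps F z = g z"
    using g by (auto simp: has_fps_expansion_def)
  have "fps_conv_radius F \<le> fps_conv_radius ?R"
    unfolding fps_conv_radius_def[of ?R]
  proof (rule conv_radius_geI_ex')
    fix r :: real assume "0 < r" "ereal r < fps_conv_radius F"
    then show "summable (\<lambda>n. fps_nth ?R n * of_real r ^ n)"
      using sums[of r] by (auto simp: sums_iff)
  qed
  with R have pos: "fps_conv_radius ?R > 0" by order
  obtain s :: real where s: "s > 0" "ereal s < fps_conv_radius F"
    using R(1) ereal_dense2[of 0 "fps_conv_radius F"] by (auto simp: zero_ereal_def)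
  then have "\<forall>\<^sub>F h::real in nhds 0. \<bar>h\<bar> < s"
    using eventually_nhds_metric[of _ "0::real"] by (auto simp: dist_norm)
  then have 1: "\<forall>\<^sub>F h::real in nhds 0. eval_fps ?R h = Re (eval_fps F (of_real h))"
  proof eventually_elim
    case (elim h)
    with s sums[of h] show ?case
      by (simp add: eval_fps_def sums_iff order_less_trans[of _ "ereal s"])
  qed
  have "filterlim (of_real :: real \<Rightarrow> complex) (nhds 0) (nhds 0)"
    using tendsto_of_real[OF filterlim_ident[of "nhds (0::real)"], where 'a = complex] by simp
  then have "\<forall>\<^sub>F h::real in nhds 0. eval_fps F (of_real h) = g (of_real h)"
    using R(2) by (rule eventually_compose_filterlim[rotated])
  with 1 f have "\<forall>\<^sub>F h in nhds 0. eval_fps ?R h = f h"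
    by eventually_elim simp
  with pos show ?thesis by (simp add: has_fps_expansion_def)
qed

text \<open>Identity theorem at a point: the zeros of a nonzero power series do not accumulate at
  its centre.\<close>

lemma has_fps_expansion_eventually_zero:
  fixes f :: "real \<Rightarrow> real"
  assumes f: "f has_fps_expansion F" and lim: "0 islimpt {h. f h = 0}"
  shows "\<forall>\<^sub>F h in nhds 0. f h = 0"
proof (cases "F = 0")
  case True
  then show ?thesis using f by (auto simp: has_fps_expansion_def elim: eventually_mono)
next
  case False
  then obtain m where m: "fps_nth F m \<noteq> 0" by (auto simp: fps_eq_iff)
  have R: "fps_conv_radius F > 0" "\<forall>\<^sub>F h in nhds 0. eval_fps F h = f h"
    using f by (auto simp: has_fps_expansion_def)
  have "\<forall>\<^sub>F h in at 0. eval_fps F h \<noteq> 0"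
  \<comment> \<open>\<open>powser_0_nonzero\<close> treats a series vanishing at its centre;
    otherwise continuity keeps the values away from zero.\<close>
  proof (cases "fps_nth F 0 = 0")
    case True
    obtain s :: real where s: "s > 0" "ereal s < fps_conv_radius F"
      using R(1) ereal_dense2[of 0 "fps_conv_radius F"] by (auto simp: zero_ereal_def)
    have sums: "(\<lambda>n. fps_nth F n * (x - 0) ^ n) sums eval_fps F x" if x: "norm (x - 0) < s" for x :: real
    proof -
      have "ereal (norm x) < ereal s" using x by simp
      then have "ereal (norm x) < fps_conv_radius F" using s(2) by (rule order_less_trans)
      then show ?thesis by (simp add: sums_eval_fps)
    qed
    have "m > 0" using m True by (cases m) auto
    obtain t where "t > 0" "\<And>z. z \<in> cball 0 t - {0} \<Longrightarrow> eval_fps F z \<noteq> 0"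
      using powser_0_nonzero[OF s(1) sums _ m \<open>m > 0\<close>] True by (auto simp: eval_fps_at_0)
    then show ?thesis
      unfolding eventually_at by (intro exI[of _ t]) (auto simp: dist_norm)
  next
    case False
    have "isCont (eval_fps F) 0"
      using R(1) by (intro continuous_eval_fps) (auto simp: zero_ereal_def)
    then have "(eval_fps F \<longlongrightarrow> fps_nth F 0) (at 0)"
      by (simp add: isCont_def eval_fps_at_0)
    then show ?thesis using False by (rule tendsto_imp_eventually_ne)
  qed
  moreover have "\<forall>\<^sub>F h in at 0. eval_fps F h = f h"
    using R(2) unfolding eventually_at_filter by (rule eventually_mono) simp
  ultimately have "\<forall>\<^sub>F h in at 0. f h \<noteq> 0" by eventually_elim simp
  then have "\<not> 0 islimpt {h. f h = 0}"
    by (simp add: islimpt_iff_eventually)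
  then show ?thesis using lim by blast
qed

text \<open>\<open>D\<close> may be disconnected. The common radius \<open>r\<close> places every
  limit of zeros inside \<open>D\<close>, so the open and closed argument runs in the whole line
  instead of a component of \<open>D\<close>.\<close>

lemma finite_zeros_analytic:
  assumes f: "real_analytic_on f D" and bdd: "bounded {z \<in> D. f z = 0}"
    and r: "r > 0" "\<And>z. z \<in> D \<Longrightarrow> f z = 0 \<Longrightarrow> ball z r \<subseteq> D"
  shows "finite {z \<in> D. f z = 0}"
proof (rule ccontr)
  define Z where "Z = {z \<in> D. f z = 0}"
  define A where "A = {z. z islimpt Z}"
  assume "infinite {z \<in> D. f z = 0}"
  then have "A \<noteq> {}"
    using bounded_infinite_imp_islimpt[of Z Z] bdd by (auto simp: A_def Z_def)
  moreover have "closed A"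
    unfolding A_def by (rule closed_limpts)
  moreover have "open A"
    unfolding open_contains_ball
  proof
    fix z assume "z \<in> A"
    then have zl: "z islimpt Z" by (simp add: A_def)
    then obtain z' where "z' \<in> Z" "dist z' z < r"
      using r(1) unfolding islimpt_approachable by blast
    then have zD: "z \<in> D" using r(2)[of z'] by (auto simp: Z_def)
    then obtain F where F: "(\<lambda>h. f (z + h)) has_fps_expansion F"
      using f by (auto simp: real_analytic_on_def)
    have "0 islimpt {h. f (z + h) = 0}"
      unfolding islimpt_approachable
    proof (intro allI impI)
      fix e :: real assume "e > 0"
      then obtain x where "x \<in> Z" "x \<noteq> z" "dist x z < e"
        using zl unfolding islimpt_approachable by blast
      then show "\<exists>h\<in>{h. f (z + h) = 0}. h \<noteq> 0 \<and> dist h 0 < e"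
        by (intro bexI[of _ "x - z"]) (auto simp: Z_def dist_norm)
    qed
    from has_fps_expansion_eventually_zero[OF F this]
    obtain d where d: "d > 0" "\<And>h. dist h 0 < d \<Longrightarrow> f (z + h) = 0"
      unfolding eventually_nhds_metric by blast
    obtain d' where d': "d' > 0" "ball z d' \<subseteq> D"
      using f zD unfolding real_analytic_on_def open_contains_ball by blast
    have "x \<in> Z" if "x \<in> ball z (min d d')" for x
      using d(2)[of "x - z"] d' that by (auto simp: Z_def dist_norm)
    then have "x islimpt Z" if "x \<in> ball z (min d d')" for x
      using that by (intro interior_limit_point interiorI[of "ball z (min d d')"]) auto
    then show "\<exists>e>0. ball z e \<subseteq> A"
      using d d' by (intro exI[of _ "min d d'"]) (auto simp: A_def)
  qed
  ultimately have "A = UNIV" using clopen by blast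
  moreover have "A \<subseteq> closure Z" by (auto simp: A_def closure_def)
  ultimately have "bounded (UNIV :: real set)"
    using bdd by (metis Z_def bounded_closure bounded_subset)
  then show False by simp
qed

section \<open>The shooting map\<close>

abbreviation cubic_rhs :: "real \<Rightarrow> (real \<Rightarrow> real) \<Rightarrow> real \<Rightarrow> real \<Rightarrow> real"
  where "cubic_rhs k g y w \<equiv> k * (w ^ 3 - w + g y)"

lemma cubic_rhs_lipschitz:
  assumes w: "\<bar>w\<bar> \<le> M" "\<bar>w'\<bar> \<le> M"
  shows "\<bar>cubic_rhs k g y w - cubic_rhs k g y w'\<bar> \<le> \<bar>k\<bar> * (3 * M\<^sup>2 + 1) * \<bar>w - w'\<bar>"
proof -
  have "w\<^sup>2 \<le> M\<^sup>2" "w'\<^sup>2 \<le> M\<^sup>2" 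
    using w by (auto intro: abs_le_square_iff[THEN iffD1])
  moreover have "\<bar>w * w'\<bar> \<le> M\<^sup>2"
    unfolding abs_mult power2_eq_square using w by (intro mult_mono) auto
  ultimately have "\<bar>w\<^sup>2 + w * w' + w'\<^sup>2 - 1\<bar> \<le> 3 * M\<^sup>2 + 1"
    by (smt (verit) zero_le_power2)
  then have "\<bar>k * (w\<^sup>2 + w * w' + w'\<^sup>2 - 1) * (w - w')\<bar> \<le> \<bar>k\<bar> * (3 * M\<^sup>2 + 1) * \<bar>w - w'\<bar>"
    unfolding abs_mult by (intro mult_right_mono mult_left_mono) auto
  also have "k * (w\<^sup>2 + w * w' + w'\<^sup>2 - 1) * (w - w') = cubic_rhs k g y w - cubic_rhs k g y w'"
    by (simp add: algebra_simps power2_eq_square power3_eq_cube)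
  finally show ?thesis .
qed

lemma cubic_rhs_unique:
  assumes "solves_ode2 a b (cubic_rhs k g) u p" "solves_ode2 a b (cubic_rhs k g) v q"
    "u a = v a" "p a = q a" "x \<in> {a..b}"
  shows "u x = v x"
  using assms by (rule solves_ode2_unique) (meson cubic_rhs_lipschitz)

text \<open>The constant 2 works because w^3 - w > 6 for w > 2, which outweighs |g| <= 1. The cubic
  is odd, so \<open>- u\<close> solves the same kind of equation with \<open>- g\<close>.\<close>

lemma cubic_rhs_bound:
  assumes u: "solves_ode2 a b (cubic_rhs k g) u p" and "p b = 0" and x: "x \<in> {a..b}" and k: "k > 0"
    and g: "\<And>y. y \<in> {a<..<b} \<Longrightarrow> \<bar>g y\<bar> \<le> 1"
  shows "\<bar>u x\<bar> \<le> max \<bar>u a\<bar> 2"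
proof -
  have pos: "0 < w ^ 3 - w + t" if "2 < w" "\<bar>t\<bar> \<le> 1" for w t :: real
  proof -
    have "2\<^sup>2 < w\<^sup>2" using that by (intro power_strict_mono) auto
    then have "2 * 3 < w * (w\<^sup>2 - 1)" using that by (intro mult_strict_mono) auto
    also have "\<dots> = w ^ 3 - w" by (simp add: algebra_simps power2_eq_square power3_eq_cube)
    finally show ?thesis using that by linarith
  qed
  have "u x \<le> max \<bar>u a\<bar> 2"
  proof (rule solves_ode2_le[OF u _ \<open>p b = 0\<close> x])
    fix y w assume "y \<in> {a<..<b}" "max \<bar>u a\<bar> 2 < w"
    then show "0 < cubic_rhs k g y w"
      using k g by (intro mult_pos_pos pos) auto
  qed simp
  moreover have "- u x \<le> max \<bar>u a\<bar> 2"
  proof (rule solves_ode2_le[OF solves_ode2_uminus[OF u] _ _ x])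
    fix y w assume "y \<in> {a<..<b}" "max \<bar>u a\<bar> 2 < w"
    then have "0 < k * (w ^ 3 - w + - g y)"
      using k g by (intro mult_pos_pos pos) auto
    then show "0 < - cubic_rhs k g y (- w)" by (simp add: algebra_simps)
  qed (simp_all add: \<open>p b = 0\<close>)
  ultimately show ?thesis by linarith
qed

text \<open>Since \<open>p 1 = 0\<close>, the mean value theorem bounds \<open>p 0\<close> by a
  value of the right-hand side, hence in terms of \<open>u 0\<close> and \<open>k\<close> only. This
  confines the zeros of the shooting map.\<close>

lemma cubic_rhs_slope_bound:
  assumes u: "solves_ode2 0 1 (cubic_rhs k g) u p" and p1: "p 1 = 0" and k: "k > 0"
    and g: "\<And>y. y \<in> {0<..<1} \<Longrightarrow> \<bar>g y\<bar> \<le> 1" and M: "M = max \<bar>u 0\<bar> 2"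
  shows "\<bar>p 0\<bar> \<le> k * (M ^ 3 + M + 1)"
proof -
  have "continuous_on {0..1} p" using u by (simp add: solves_ode2_def)
  moreover have "(p has_derivative (*) (cubic_rhs k g t (u t))) (at t)" if "0 < t" "t < 1" for t
  proof -
    obtain q where "\<forall>x\<in>{0<..<1}. (p has_real_derivative q x) (at x) \<and> - q x + cubic_rhs k g x (u x) = 0"
      using u unfolding solves_ode2_def by blast
    then have "(p has_real_derivative q t) (at t)" "q t = cubic_rhs k g t (u t)"
      using that by auto
    then show ?thesis unfolding has_field_derivative_def by simp
  qed
  ultimately obtain t where t: "0 < t" "t < 1" "p 1 - p 0 = cubic_rhs k g t (u t) * (1 - 0)"
    using mvt[OF zero_less_one, of p "\<lambda>t. (*) (cubic_rhs k g t (u t))"] by blast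
  have "\<bar>u t\<bar> \<le> M" using cubic_rhs_bound[OF u p1 _ k g] t M by auto
  moreover from this have "\<bar>u t\<bar> ^ 3 \<le> M ^ 3" by (intro power_mono) auto
  ultimately have "\<bar>u t ^ 3 - u t + g t\<bar> \<le> M ^ 3 + M + 1"
    using g[of t] t by (simp add: power_abs[symmetric] abs_le_iff)
  then have "\<bar>cubic_rhs k g t (u t)\<bar> \<le> k * (M ^ 3 + M + 1)"
    using k by (simp add: abs_mult)
  then show ?thesis using t p1 by simp
qed

text \<open>The relation for \<open>T\<close> is asked only along the sum of the two solutions, so
  this superposition also fits a nonlinear equation and its equation for differences.\<close>

lemma solves_ode2_add:
  assumes v: "solves_ode2 a b R v p" and w: "solves_ode2 a b S w q"
    and T: "\<And>x. x \<in> {a<..<b} \<Longrightarrow> T x (v x + w x) = R x (v x) + S x (w x)"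
  shows "solves_ode2 a b T (\<lambda>x. v x + w x) (\<lambda>x. p x + q x)"
proof -
  obtain r where r: "continuous_on {a<..<b} r"
    "\<And>x. x \<in> {a<..<b} \<Longrightarrow> (p has_real_derivative r x) (at x)"
    "\<And>x. x \<in> {a<..<b} \<Longrightarrow> - r x + R x (v x) = 0"
    using v unfolding solves_ode2_def by blast
  obtain s where s: "continuous_on {a<..<b} s"
    "\<And>x. x \<in> {a<..<b} \<Longrightarrow> (q has_real_derivative s x) (at x)"
    "\<And>x. x \<in> {a<..<b} \<Longrightarrow> - s x + S x (w x) = 0"
    using w unfolding solves_ode2_def by blast
  have "- (r x + s x) + T x (v x + w x) = 0" if "x \<in> {a<..<b}" for x
    using r(3)[OF that] s(3)[OF that] T[OF that] by simp
  moreover have "((\<lambda>x. p x + q x) has_real_derivative r x + s x) (at x)" if "x \<in> {a<..<b}" for x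
    using r(2)[OF that] s(2)[OF that] by (rule DERIV_add)
  moreover have "continuous_on {a<..<b} (\<lambda>x. r x + s x)"
    using r(1) s(1) by (rule continuous_on_add)
  moreover have "continuous_on {a..b} (\<lambda>x. p x + q x)"
    using v w unfolding solves_ode2_def by (blast intro: continuous_on_add)
  moreover have "((\<lambda>x. v x + w x) has_real_derivative p x + q x) (at x within {a..b})"
    if "x \<in> {a..b}" for x
    using v w that unfolding solves_ode2_def by (blast intro: DERIV_add)
  ultimately show ?thesis unfolding solves_ode2_def by blast
qed

text \<open>The order of quantifiers matters: \<open>r\<close> is fixed from \<open>k\<close> and
  \<open>M\<close> before the solution \<open>v\<close> is given.\<close>

lemma cubic_rhs_analytic_flow:
  fixes k M :: real
  obtains r where "r > 0"
    and "\<And>g v p. solves_ode2 0 1 (cubic_rhs k g) v p \<Longrightarrow> (\<And>y. y \<in> {0..1} \<Longrightarrow> \<bar>v y\<bar> \<le> M) \<Longrightarrow>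
      \<exists>\<Phi>. \<Phi> holomorphic_on ball 0 r \<and> (\<forall>h. \<bar>h\<bar> < r \<longrightarrow> (\<exists>u q. solves_ode2 0 1 (cubic_rhs k g) u q \<and>
        u 0 = v 0 \<and> q 0 = p 0 + h \<and> q 1 = p 1 + Re (\<Phi> (of_real h))))"
proof
  \<comment> \<open>Bounds |a| + 2 |b| + 3 |c| for the coefficients below whenever |v| <= M.\<close>
  define B where "B = \<bar>k\<bar> * (3 * M\<^sup>2 + 1 + 6 * M + 3)"
  let ?r = "exp (- (2 * B + 1)) / 2"
  show "?r > 0" by simp
  fix g v p
  assume v: "solves_ode2 0 1 (cubic_rhs k g) v p" and M: "\<And>y. y \<in> {0..1} \<Longrightarrow> \<bar>v y\<bar> \<le> M"
  \<comment> \<open>Taylor coefficients of k (w^3 - w) about \<open>v y\<close>; the inhomogeneity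
    \<open>g\<close> cancels in the difference.\<close>
  interpret cubic_picard "\<lambda>y. k * (3 * (v y)\<^sup>2 - 1)" "\<lambda>y. k * (3 * v y)" k B
  proof
    have vc: "continuous_on {0..1} v" using v by (rule solves_ode2_continuous)
    show "continuous_on {0..1} (\<lambda>y. k * (3 * (v y)\<^sup>2 - 1))" "continuous_on {0..1} (\<lambda>y. k * (3 * v y))"
      by (intro continuous_intros vc)+
    fix s :: real assume s: "s \<in> {0..1}"
    have "(v s)\<^sup>2 \<le> M\<^sup>2" using M[OF s] by (auto intro: abs_le_square_iff[THEN iffD1])
    then have "\<bar>3 * (v s)\<^sup>2 - 1\<bar> + 2 * \<bar>3 * v s\<bar> + 3 \<le> 3 * M\<^sup>2 + 1 + 6 * M + 3"
      using M[OF s] by (smt (verit) zero_le_power2)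
    from mult_left_mono[OF this, of "\<bar>k\<bar>"]
    show "\<bar>k * (3 * (v s)\<^sup>2 - 1)\<bar> + 2 * \<bar>k * (3 * v s)\<bar> + 3 * \<bar>k\<bar> \<le> B"
      unfolding B_def abs_mult by (simp add: algebra_simps)
  qed
  have "\<exists>u q. solves_ode2 0 1 (cubic_rhs k g) u q \<and> u 0 = v 0 \<and> q 0 = p 0 + h \<and>
      q 1 = p 1 + Re (slope (of_real h) 1)" if "\<bar>h\<bar> < ?r" for h
  proof (intro exI conjI)
    have h: "\<bar>h\<bar> \<le> ?r" using that by simp
    show "solves_ode2 0 1 (cubic_rhs k g) (\<lambda>y. v y + Re (solution (of_real h) y))
        (\<lambda>y. p y + Re (slope (of_real h) y))"
      by (rule solves_ode2_add[OF v real_solution(1)[OF h]])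
        (simp add: algebra_simps power2_eq_square power3_eq_cube)
    show "v 0 + Re (solution (of_real h) 0) = v 0" using real_solution(2)[OF h] by simp
    show "p 0 + Re (slope (of_real h) 0) = p 0 + h" using real_solution(3)[OF h] by simp
  qed simp
  then show "\<exists>\<Phi>. \<Phi> holomorphic_on ball 0 ?r \<and> (\<forall>h. \<bar>h\<bar> < ?r \<longrightarrow> (\<exists>u q. solves_ode2 0 1 (cubic_rhs k g) u q \<and>
        u 0 = v 0 \<and> q 0 = p 0 + h \<and> q 1 = p 1 + Re (\<Phi> (of_real h))))"
    using slope_holomorphic[of 1] by (intro exI[of _ "\<lambda>h. slope h 1"]) simp
qed

section \<open>Values and analyticity of the shooting map\<close>

abbreviation scaled_ode :: "(real \<Rightarrow> real) \<Rightarrow> real \<Rightarrow> (real \<Rightarrow> real) \<Rightarrow> (real \<Rightarrow> real) \<Rightarrow> bool"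
  where "scaled_ode \<zeta> L \<equiv> solves_ode2 0 1 (\<lambda>y w. L\<^sup>2 * (w ^ 3 - w + \<zeta> (L * y)))"

lemma shooting_domainE:
  assumes "z \<in> shooting_domain \<zeta> c0 L"
  obtains v p where "scaled_ode \<zeta> L v p" "v 0 = c0" "p 0 = z"
  using assms unfolding shooting_domain_def ivp_solution_def by blast

text \<open>Uniqueness for the initial value problem gives the \<open>THE\<close> in
  \<open>v_tilde\<close> its meaning. Any solution at hand, restricted to [0, 1], then computes the
  shooting map.\<close>

lemma shooting_solution:
  assumes v: "scaled_ode \<zeta> L v p" and v0: "v 0 = c0"
  shows "p 0 \<in> shooting_domain \<zeta> c0 L"
    and "v_tilde \<zeta> c0 L (p 0) = restrict v {0..1}"
    and "shooting_map \<zeta> c0 L (p 0) = p 1"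
proof -
  have rv: "scaled_ode \<zeta> L (restrict v {0..1}) p"
    using v by (rule solves_ode2_cong) auto
  then have iv: "ivp_solution \<zeta> c0 L (p 0) (restrict v {0..1})"
    using v0 unfolding ivp_solution_def by auto
  then show "p 0 \<in> shooting_domain \<zeta> c0 L" unfolding shooting_domain_def by blast
  have "u = restrict v {0..1}" if "ivp_solution \<zeta> c0 L (p 0) u" for u
  proof
    fix x
    from that obtain q where "scaled_ode \<zeta> L u q" "u 0 = c0" "q 0 = p 0" "u \<in> extensional {0..1}"
      unfolding ivp_solution_def by blast
    with cubic_rhs_unique[OF _ v, of u q x] v0 show "u x = restrict v {0..1} x"
      by (cases "x \<in> {0..1}") (auto simp: extensional_def)
  qed
  with iv show eq: "v_tilde \<zeta> c0 L (p 0) = restrict v {0..1}"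
    unfolding v_tilde_def by blast
  have "(restrict v {0..1} has_vector_derivative p 1) (at 1 within cbox 0 1)"
    using rv unfolding solves_ode2_def by (auto simp: has_real_derivative_iff_has_vector_derivative)
  then show "shooting_map \<zeta> c0 L (p 0) = p 1"
    unfolding shooting_map_def eq using vector_derivative_within_cbox[of 0 1 1] by simp
qed

text \<open>Near \<open>z\<close> the shooting map is the real part of a holomorphic function along
  the real axis.\<close>

lemma shooting_analytic_at:
  assumes r: "\<Phi> holomorphic_on ball 0 r" "r > 0"
    and ex: "\<And>h. \<bar>h\<bar> < r \<Longrightarrow>
      \<exists>u q. scaled_ode \<zeta> L u q \<and> u 0 = c0 \<and> q 0 = z + h \<and> q 1 = e + Re (\<Phi> (of_real h))"
  shows "ball z r \<subseteq> shooting_domain \<zeta> c0 L"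
    and "\<exists>F. (\<lambda>h. shooting_map \<zeta> c0 L (z + h)) has_fps_expansion F"
proof -
  have *: "z + h \<in> shooting_domain \<zeta> c0 L \<and> shooting_map \<zeta> c0 L (z + h) = Re (of_real e + \<Phi> (of_real h))"
    if h: "\<bar>h\<bar> < r" for h
  proof -
    obtain u q where u: "scaled_ode \<zeta> L u q" "u 0 = c0" "q 0 = z + h" "q 1 = e + Re (\<Phi> (of_real h))"
      using ex[OF h] by blast
    then show ?thesis using shooting_solution(1,3)[OF u(1,2)] by simp
  qed
  show "ball z r \<subseteq> shooting_domain \<zeta> c0 L"
  proof
    fix x assume "x \<in> ball z r"
    then show "x \<in> shooting_domain \<zeta> c0 L"
      using *[of "x - z"] by (simp add: dist_norm abs_minus_commute)
  qed
  have "(\<lambda>h. of_real e + \<Phi> h) has_fps_expansion fps_expansion (\<lambda>h. of_real e + \<Phi> h) 0"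
  proof (rule has_fps_expansion_fps_expansion)
    show "(\<lambda>h. of_real e + \<Phi> h) holomorphic_on ball 0 r"
      by (rule holomorphic_on_add[OF holomorphic_on_const r(1)])
  qed (use r(2) in simp_all)
  moreover have "\<forall>\<^sub>F h in nhds 0. shooting_map \<zeta> c0 L (z + h) = Re (of_real e + \<Phi> (of_real h))"
    unfolding eventually_nhds_metric
  proof (intro exI conjI allI impI)
    fix h :: real assume "dist h 0 < r"
    then show "shooting_map \<zeta> c0 L (z + h) = Re (of_real e + \<Phi> (of_real h))"
      using *[of h] by (simp only: dist_norm diff_zero real_norm_def)
  qed (rule r(2))
  ultimately show "\<exists>F. (\<lambda>h. shooting_map \<zeta> c0 L (z + h)) has_fps_expansion F"
    by (intro exI) (rule has_fps_expansion_Re)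
qed

text \<open>Used with the bound of an individual solution for analyticity, and with one
  \<open>M\<close> for all zeros to obtain their common radius.\<close>

lemma shooting_analytic_uniform:
  obtains r where "r > 0"
    and "\<And>v p. scaled_ode \<zeta> L v p \<Longrightarrow> v 0 = c0 \<Longrightarrow> (\<And>y. y \<in> {0..1} \<Longrightarrow> \<bar>v y\<bar> \<le> M) \<Longrightarrow>
      ball (p 0) r \<subseteq> shooting_domain \<zeta> c0 L \<and>
      (\<exists>F. (\<lambda>h. shooting_map \<zeta> c0 L (p 0 + h)) has_fps_expansion F)"
proof (rule cubic_rhs_analytic_flow[of "L\<^sup>2" M])
  fix r :: real
  assume r: "r > 0" and fl: "\<And>g v p. solves_ode2 0 1 (cubic_rhs (L\<^sup>2) g) v p \<Longrightarrow>
      (\<And>y. y \<in> {0..1} \<Longrightarrow> \<bar>v y\<bar> \<le> M) \<Longrightarrow>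
      \<exists>\<Phi>. \<Phi> holomorphic_on ball 0 r \<and> (\<forall>h. \<bar>h\<bar> < r \<longrightarrow> (\<exists>u q. solves_ode2 0 1 (cubic_rhs (L\<^sup>2) g) u q \<and>
        u 0 = v 0 \<and> q 0 = p 0 + h \<and> q 1 = p 1 + Re (\<Phi> (of_real h))))"
  show thesis
  proof (rule that[OF r])
    fix v p
    assume v: "scaled_ode \<zeta> L v p" "v 0 = c0" and M: "\<And>y. y \<in> {0..1} \<Longrightarrow> \<bar>v y\<bar> \<le> M"
    obtain \<Phi> where \<Phi>: "\<Phi> holomorphic_on ball 0 r"
      and ex: "\<forall>h. \<bar>h\<bar> < r \<longrightarrow> (\<exists>u q. scaled_ode \<zeta> L u q \<and>
        u 0 = v 0 \<and> q 0 = p 0 + h \<and> q 1 = p 1 + Re (\<Phi> (of_real h)))"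
      by (rule fl[OF v(1), THEN exE], rule M, assumption) (erule conjE, rule that)
    note at = shooting_analytic_at[OF \<Phi> r ex[rule_format], unfolded v(2)]
    show "ball (p 0) r \<subseteq> shooting_domain \<zeta> c0 L \<and>
      (\<exists>F. (\<lambda>h. shooting_map \<zeta> c0 L (p 0 + h)) has_fps_expansion F)"
      by (intro conjI at)
  qed
qed

lemma real_analytic_shooting_map:
  "real_analytic_on (shooting_map \<zeta> c0 L) (shooting_domain \<zeta> c0 L)"
proof -
  have "(\<exists>r>0. ball z r \<subseteq> shooting_domain \<zeta> c0 L) \<and>
      (\<exists>F. (\<lambda>h. shooting_map \<zeta> c0 L (z + h)) has_fps_expansion F)"
    if "z \<in> shooting_domain \<zeta> c0 L" for z
  proof -
    from that obtain v p where v: "scaled_ode \<zeta> L v p" "v 0 = c0" "p 0 = z"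
      by (rule shooting_domainE)
    obtain M where M: "\<And>y. y \<in> {0..1} \<Longrightarrow> \<bar>v y\<bar> \<le> M"
      using v(1) by (rule solves_ode2_bounded) blast
    show ?thesis
      by (rule shooting_analytic_uniform[where \<zeta> = \<zeta> and L = L and ?c0.0 = c0 and M = M]) (use v M in blast)
  qed
  then show ?thesis
    unfolding real_analytic_on_def open_contains_ball by blast
qed

lemma finite_shooting_zeros:
  assumes L: "L > 0" and \<zeta>: "\<And>x. x \<in> {0..L} \<Longrightarrow> \<bar>\<zeta> x\<bar> \<le> 1"
  shows "finite {z \<in> shooting_domain \<zeta> c0 L. shooting_map \<zeta> c0 L z = 0}"
proof -
  \<comment> \<open>By \<open>cubic_rhs_bound\<close> this bounds the solution of every zero, so a
    single \<open>r\<close> serves them all.\<close>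
  define M where "M = max \<bar>c0\<bar> 2"
  have zero: "\<exists>v p. scaled_ode \<zeta> L v p \<and> v 0 = c0 \<and> p 0 = z \<and> p 1 = 0"
    if z: "z \<in> shooting_domain \<zeta> c0 L" "shooting_map \<zeta> c0 L z = 0" for z
  proof -
    obtain v p where v: "scaled_ode \<zeta> L v p" "v 0 = c0" "p 0 = z"
      using z(1) by (rule shooting_domainE)
    then show ?thesis using shooting_solution(3)[OF v(1,2)] z(2) by auto
  qed
  have \<zeta>': "\<bar>\<zeta> (L * y)\<bar> \<le> 1" if "y \<in> {0<..<1}" for y
    using that L by (intro \<zeta>) auto
  have L2: "L\<^sup>2 > 0" using L by simp
  obtain r where r: "r > 0"
    and ball: "\<And>v p. scaled_ode \<zeta> L v p \<Longrightarrow> v 0 = c0 \<Longrightarrow> (\<And>y. y \<in> {0..1} \<Longrightarrow> \<bar>v y\<bar> \<le> M) \<Longrightarrow>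
      ball (p 0) r \<subseteq> shooting_domain \<zeta> c0 L"
    by (rule shooting_analytic_uniform[where \<zeta> = \<zeta> and L = L and ?c0.0 = c0 and M = M]) blast
  show ?thesis
  proof (rule finite_zeros_analytic[OF real_analytic_shooting_map _ r])
    have "\<bar>z\<bar> \<le> L\<^sup>2 * (M ^ 3 + M + 1)"
      if z: "z \<in> shooting_domain \<zeta> c0 L" "shooting_map \<zeta> c0 L z = 0" for z
    proof -
      obtain v p where v: "scaled_ode \<zeta> L v p" "v 0 = c0" "p 0 = z" "p 1 = 0"
        using zero[OF z] by blast
      have "\<bar>p 0\<bar> \<le> L\<^sup>2 * (M ^ 3 + M + 1)"
        by (rule cubic_rhs_slope_bound[OF v(1,4) L2 \<zeta>']) (simp_all add: M_def v(2))
      then show ?thesis using v(3) by simp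
    qed
    then show "bounded {z \<in> shooting_domain \<zeta> c0 L. shooting_map \<zeta> c0 L z = 0}"
      unfolding bounded_iff by (intro exI[of _ "L\<^sup>2 * (M ^ 3 + M + 1)"]) auto
    fix z assume "z \<in> shooting_domain \<zeta> c0 L" "shooting_map \<zeta> c0 L z = 0"
    with zero obtain v p where v: "scaled_ode \<zeta> L v p" "v 0 = c0" "p 0 = z" "p 1 = 0" by blast
    have "\<bar>v y\<bar> \<le> M" if "y \<in> {0..1}" for y
      using cubic_rhs_bound[OF v(1,4) that L2 \<zeta>'] v(2) by (simp add: M_def)
    then show "ball z r \<subseteq> shooting_domain \<zeta> c0 L"
      using ball[OF v(1,2)] v(3) by blast
  qed
qed

section \<open>Correspondence between initial slopes and boundary value solutions\<close>

lemma solves_ode2_slope_unique: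
  assumes "solves_ode2 a b R u p" "solves_ode2 a b S u q" "a < b" "x \<in> {a..b}"
  shows "p x = q x"
proof -
  have "(u has_vector_derivative p x) (at x within cbox a b)"
    "(u has_vector_derivative q x) (at x within cbox a b)"
    using assms unfolding solves_ode2_def
    by (simp_all add: has_real_derivative_iff_has_vector_derivative)
  note vector_derivative_within_cbox[OF \<open>a < b\<close> _ this(1)] vector_derivative_within_cbox[OF \<open>a < b\<close> _ this(2)]
  then show ?thesis using \<open>x \<in> {a..b}\<close> by simp
qed

lemma bij_betw_shooting_zeros:
  assumes L: "L > 0"
  shows "bij_betw (\<lambda>z. \<lambda>x\<in>{0..L}. v_tilde \<zeta> c0 L z (x / L) - c0)
    {z \<in> shooting_domain \<zeta> c0 L. shooting_map \<zeta> c0 L z = 0} (bvp_solutions \<zeta> c0 L)"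
    (is "bij_betw ?f ?Z ?B")
proof -
  have f: "?f (p 0) = (\<lambda>x\<in>{0..L}. v (x / L) - c0)" if "scaled_ode \<zeta> L v p" "v 0 = c0" for v p
    unfolding shooting_solution(2)[OF that] by (rule restrict_ext) (use L in auto)
  have "inj_on ?f ?Z"
  proof (rule inj_onI)
    fix z z' assume z: "z \<in> ?Z" "z' \<in> ?Z" and eq: "?f z = ?f z'"
    from z(1) obtain v p where v: "scaled_ode \<zeta> L v p" "v 0 = c0" "p 0 = z"
      by (auto elim: shooting_domainE)
    from z(2) obtain w q where w: "scaled_ode \<zeta> L w q" "w 0 = c0" "q 0 = z'"
      by (auto elim: shooting_domainE)
    have eq': "(\<lambda>x\<in>{0..L}. v (x / L) - c0) = (\<lambda>x\<in>{0..L}. w (x / L) - c0)"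
      using eq f[OF v(1,2)] f[OF w(1,2)] unfolding v(3) w(3) by simp
    have "v y = w y" if "y \<in> {0..1}" for y
      using fun_cong[OF eq', of "L * y"] that L by simp
    then have "scaled_ode \<zeta> L w p" by (rule solves_ode2_cong[OF v(1)]) simp_all
    \<comment> \<open>The derivative on [0, 1] is unique even at the end 0, where it is one-sided,
      so the common profile determines the initial slope.\<close>
    then have "p 0 = q 0" by (rule solves_ode2_slope_unique[OF _ w(1)]) auto
    then show "z = z'" using v w by simp
  qed
  moreover have "?f z \<in> ?B" if z: "z \<in> ?Z" for z
  proof -
    from z obtain v p where v: "scaled_ode \<zeta> L v p" "v 0 = c0" "p 0 = z"
      by (auto elim: shooting_domainE)
    have p1: "p 1 = 0" using shooting_solution(3)[OF v(1,2)] z v(3) by simp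
    let ?u = "\<lambda>x\<in>{0..L}. v (x / L) - c0" and ?p = "\<lambda>x. 1 / L * p (1 / L * x)"
    have "solves_ode2 (0 / (1 / L)) (1 / (1 / L)) (\<lambda>x w. (w + c0) ^ 3 - (w + c0) + \<zeta> x)
        (\<lambda>x. v (1 / L * x) + - c0) ?p"
      by (rule solves_ode2_rescale[OF v(1)]) (use L in \<open>auto simp: power_divide\<close>)
    then have "solves_ode2 0 L (\<lambda>x w. (w + c0) ^ 3 - (w + c0) + \<zeta> x) (\<lambda>x. v (1 / L * x) + - c0) ?p"
      by simp
    then have "solves_ode2 0 L (\<lambda>x w. (w + c0) ^ 3 - (w + c0) + \<zeta> x) ?u ?p"
      by (rule solves_ode2_cong) auto
    moreover have "?u 0 = 0" "?p L = 0" using L v(2) p1 by simp_all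
    ultimately have "?u \<in> ?B" unfolding bvp_solutions_def by blast
    then show ?thesis using f[OF v(1,2)] unfolding v(3) by simp
  qed
  moreover have "u \<in> ?f ` ?Z" if "u \<in> ?B" for u
  proof -
    from that obtain p where u: "u \<in> extensional {0..L}" "u 0 = 0" "p L = 0"
      "solves_ode2 0 L (\<lambda>x w. (w + c0) ^ 3 - (w + c0) + \<zeta> x) u p"
      unfolding bvp_solutions_def by blast
    let ?v = "\<lambda>y. u (L * y) + c0" and ?p = "\<lambda>y. L * p (L * y)"
    have "solves_ode2 (0 / L) (L / L) (\<lambda>y w. L\<^sup>2 * (w ^ 3 - w + \<zeta> (L * y))) ?v ?p"
      by (rule solves_ode2_rescale[OF u(4) L]) simp
    then have v: "scaled_ode \<zeta> L ?v ?p" "?v 0 = c0" using L u(2) by simp_all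
    \<comment> \<open>Outside \<open>{0..L}\<close> both sides are \<open>undefined\<close>, by
      \<open>restrict\<close> on the left and by \<open>extensional\<close> for
      \<open>u\<close>.\<close>
    have "?f (?p 0) = u"
      unfolding f[OF v] using u(1) L by (auto simp: extensional_def)
    moreover have "?p 0 \<in> ?Z"
      using shooting_solution(1,3)[OF v] u(3) by simp
    ultimately show ?thesis by (intro image_eqI[of u ?f "?p 0"]) simp_all
  qed
  ultimately show ?thesis
    unfolding bij_betw_def by (intro conjI subset_antisym image_subsetI subsetI)
qed

theorem theorem2p5:
  fixes \<zeta> :: "real \<Rightarrow> real" and J :: "real set" and L c0 :: real
  assumes "L > 0"
    and "open J" and "is_interval J" and "{0..L} \<subseteq> J"
    and "real_analytic_on \<zeta> J"
    and "\<forall>x\<in>J. -1 < \<zeta> x \<and> \<zeta> x < 0"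
  shows "finite (bvp_solutions \<zeta> c0 L)
    \<and> real_analytic_on (shooting_map \<zeta> c0 L) (shooting_domain \<zeta> c0 L)
    \<and> bij_betw (\<lambda>z. \<lambda>x\<in>{0..L}. v_tilde \<zeta> c0 L z (x / L) - c0)
        {z \<in> shooting_domain \<zeta> c0 L. shooting_map \<zeta> c0 L z = 0}
        (bvp_solutions \<zeta> c0 L)"
proof -
  have bij: "bij_betw (\<lambda>z. \<lambda>x\<in>{0..L}. v_tilde \<zeta> c0 L z (x / L) - c0)
      {z \<in> shooting_domain \<zeta> c0 L. shooting_map \<zeta> c0 L z = 0} (bvp_solutions \<zeta> c0 L)"
    using \<open>L > 0\<close> by (rule bij_betw_shooting_zeros)
  have "\<bar>\<zeta> x\<bar> \<le> 1" if "x \<in> {0..L}" for x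
    using assms(4,6) that by fastforce
  with \<open>L > 0\<close> have "finite {z \<in> shooting_domain \<zeta> c0 L. shooting_map \<zeta> c0 L z = 0}"
    by (rule finite_shooting_zeros)
  then have "finite (bvp_solutions \<zeta> c0 L)"
    using bij_betw_finite[OF bij] by simp
  then show ?thesis by (intro conjI real_analytic_shooting_map bij)
qed

end
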